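(* Let $M$ and $N$ be JBW-factors of type I with units $e_M$ and $e_N$, and let $f\colon[0,e_M]\to[0,e_N]$ be an order isomorphism. Then $f((0,e_M])=(0,e_N]$.
   Context: A JB-algebra is a real Banach space $A$ with a commutative bilinear product $\circ$ satisfying $x\circ(y\circ x^2)=(x\circ y)\circ x^2$, $\|x\circ y\|\le\|x\|\|y\|$, $\|x^2\|=\|x\|^2$ and $\|x^2\|\le\|x^2+y^2\|$ for all $x,y\in A$. A JBW-algebra is a JB-algebra that is a dual Banach space; it has a unit $e$. $x\le y$ means that $y-x$ lies in the cone of squares, and $[x,y]=\{w: x\le w\le y\}$. An element $x$ is invertible if it is invertible in the JB-subalgebra generated by $x$ and $e$ (which is isomorphic to $C(\sigma(x))$). $(0,e]$ denotes the set of invertible elements of $[0,e]$. An order isomorphism is a bijection $f$ with $x\le y\iff f(x)\le f(y)$. Elements $x,y$ operator commute if $x\circ(y\circ w)=y\circ(x\circ w)$ for all $w$. A JBW-factor is a JBW-algebra in which the only elements operator commuting with all elements are the multiples of $e$. The atomic JBW-algebras (those in which every non-zero projection, i.e. element $p$ with $p^2=p$, dominates a minimal non-zero projection) are direct sums of type I factors. Up to isomorphism, the type I factors are spin factors, the self-adjoint $3\times3$ octonionic matrices $\mathrm{Mat}_3(\mathbb{O})_{sa}$, and $B(H)_{sa}$ with $H$ a real, complex or quaternionic Hilbert space (together with the one-dimensional algebra $\mathbb{R}$). *)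

theory Defs
  imports "HOL-Analysis.Analysis"
begin

locale JB_algebra =
  fixes jp :: "'a::banach \<Rightarrow> 'a \<Rightarrow> 'a"
  assumes bilinear: "bilinear jp"
    and commute: "jp x y = jp y x"
    and jordan: "jp x (jp y (jp x x)) = jp (jp x y) (jp x x)"
    and norm_prod: "norm (jp x y) \<le> norm x * norm y"
    and norm_square: "norm (jp x x) = (norm x)\<^sup>2"
    and norm_square_add: "norm (jp x x) \<le> norm (jp x x + jp y y)"

(* The type argument 'p carries the predual: 'a is a dual Banach space if it is isometrically
   isomorphic to the space of bounded linear functionals on some Banach space 'p. *)
definition dual_of_banach :: "'a::banach itself \<Rightarrow> 'p::banach itself \<Rightarrow> bool" where
  "dual_of_banach _ _ \<longleftrightarrow>
     (\<exists>T :: 'a \<Rightarrow> ('p \<Rightarrow>\<^sub>L real). linear T \<and> bij T \<and> (\<forall>x. norm (T x) = norm x))"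

(* Any statement proved for all types 'p is a statement about all algebras for which a
   predual exists. *)
locale JBW_algebra = JB_algebra jp
  for jp :: "'a::banach \<Rightarrow> 'a \<Rightarrow> 'a" +
  fixes e :: 'a and predual :: "'p::banach itself"
  assumes unit: "jp e x = x"
    and dual: "dual_of_banach TYPE('a) predual"

definition jb_le :: "('a::banach \<Rightarrow> 'a \<Rightarrow> 'a) \<Rightarrow> 'a \<Rightarrow> 'a \<Rightarrow> bool" where
  "jb_le jp x y \<longleftrightarrow> (\<exists>z. y - x = jp z z)"

definition jb_interval :: "('a::banach \<Rightarrow> 'a \<Rightarrow> 'a) \<Rightarrow> 'a \<Rightarrow> 'a \<Rightarrow> 'a set" where
  "jb_interval jp x y = {w. jb_le jp x w \<and> jb_le jp w y}"

definition jb_subalgebra :: "('a::banach \<Rightarrow> 'a \<Rightarrow> 'a) \<Rightarrow> 'a set \<Rightarrow> bool" where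
  "jb_subalgebra jp S \<longleftrightarrow> subspace S \<and> closed S \<and> (\<forall>x\<in>S. \<forall>y\<in>S. jp x y \<in> S)"

definition jb_invertible :: "('a::banach \<Rightarrow> 'a \<Rightarrow> 'a) \<Rightarrow> 'a \<Rightarrow> 'a \<Rightarrow> bool" where
  "jb_invertible jp e x \<longleftrightarrow> (\<exists>y \<in> jb_subalgebra jp hull {x, e}. jp x y = e)"

definition invertible_effects :: "('a::banach \<Rightarrow> 'a \<Rightarrow> 'a) \<Rightarrow> 'a \<Rightarrow> 'a set" where
  "invertible_effects jp e = {x \<in> jb_interval jp 0 e. jb_invertible jp e x}"

definition operator_commute :: "('a::banach \<Rightarrow> 'a \<Rightarrow> 'a) \<Rightarrow> 'a \<Rightarrow> 'a \<Rightarrow> bool" where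
  "operator_commute jp x y \<longleftrightarrow> (\<forall>w. jp x (jp y w) = jp y (jp x w))"

definition jb_central :: "('a::banach \<Rightarrow> 'a \<Rightarrow> 'a) \<Rightarrow> 'a \<Rightarrow> bool" where
  "jb_central jp x \<longleftrightarrow> (\<forall>y. operator_commute jp x y)"

locale JBW_factor = JBW_algebra jp e predual
  for jp :: "'a::banach \<Rightarrow> 'a \<Rightarrow> 'a" and e :: 'a and predual :: "'p::banach itself" +
  assumes factor: "jb_central jp x \<Longrightarrow> \<exists>c::real. x = c *\<^sub>R e"

definition jb_projection :: "('a::banach \<Rightarrow> 'a \<Rightarrow> 'a) \<Rightarrow> 'a \<Rightarrow> bool" where
  "jb_projection jp p \<longleftrightarrow> jp p p = p"

(* For special Jordan algebras this is a \<mapsto> pap. *)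
definition jb_U :: "('a::banach \<Rightarrow> 'a \<Rightarrow> 'a) \<Rightarrow> 'a \<Rightarrow> 'a \<Rightarrow> 'a" where
  "jb_U jp p a = 2 *\<^sub>R jp p (jp p a) - jp (jp p p) a"

(* A projection p is abelian if its Peirce algebra U_p(M) is associative. *)
definition abelian_projection :: "('a::banach \<Rightarrow> 'a \<Rightarrow> 'a) \<Rightarrow> 'a \<Rightarrow> bool" where
  "abelian_projection jp p \<longleftrightarrow> jb_projection jp p \<and>
     (\<forall>a \<in> range (jb_U jp p). \<forall>b \<in> range (jb_U jp p). \<forall>c \<in> range (jb_U jp p).
        jp (jp a b) c = jp a (jp b c))"

(* The central cover of p is the least central projection dominating p. *)
definition is_central_cover :: "('a::banach \<Rightarrow> 'a \<Rightarrow> 'a) \<Rightarrow> 'a \<Rightarrow> 'a \<Rightarrow> bool" where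
  "is_central_cover jp p c \<longleftrightarrow>
     jb_projection jp c \<and> jb_central jp c \<and> jb_le jp p c \<and>
     (\<forall>q. jb_projection jp q \<and> jb_central jp q \<and> jb_le jp p q \<longrightarrow> jb_le jp c q)"

(* The general type I condition for JBW-algebras (Hanche-Olsen and Stormer; Alfsen and Shultz).
   For factors it is equivalent to being atomic. *)
locale JBW_factor_type_I = JBW_factor jp e predual
  for jp :: "'a::banach \<Rightarrow> 'a \<Rightarrow> 'a" and e :: 'a and predual :: "'p::banach itself" +
  assumes type_I: "\<exists>p. abelian_projection jp p \<and> is_central_cover jp p e"

definition order_isomorphism_on ::
    "('a \<Rightarrow> 'a \<Rightarrow> bool) \<Rightarrow> 'a set \<Rightarrow> ('b \<Rightarrow> 'b \<Rightarrow> bool) \<Rightarrow> 'b set \<Rightarrow> ('a \<Rightarrow> 'b) \<Rightarrow> bool" where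
  "order_isomorphism_on leA A leB B f \<longleftrightarrow>
     bij_betw f A B \<and> (\<forall>x\<in>A. \<forall>y\<in>A. leA x y \<longleftrightarrow> leB (f x) (f y))"

end

theory Submission
  imports Defs
begin

text \<open>In a type I factor, an effect \<open>x\<close> is invertible if and only if every nonzero effect has a common
  nonzero lower bound with \<open>x\<close>, and this condition is preserved by order isomorphisms of the effects.

  If \<open>x\<close> is invertible, then \<open>c e \<le> x\<close> for some \<open>0 < c \<le> 1\<close>, and \<open>c a\<close> lies below \<open>a\<close> and \<open>x\<close>.
  Conversely, fix a minimal projection \<open>p\<close>. The atoms near \<open>p\<close> are parametrized by the Peirce
  1/2-space of \<open>p\<close>, and each of them is dominated by a multiple of \<open>x\<close>; Baire's theorem makes the multiple
  uniform. This shows that the compression of \<open>x\<close> to the Peirce 0-space acts on the 1/2-space, a Hilbert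
  space, as an operator that is bounded below. In a factor this action is faithful, because the
  unit of its kernel is a central projection; hence the compression, and then \<open>x\<close> itself,
  is bounded below by a positive multiple of the unit.\<close>

text \<open>In \<open>B(H)_sa\<close> a positive \<open>x\<close> dominates a positive multiple of
  the projection onto a unit vector \<xi> exactly when \<xi> lies in the range of the square root of
  \<open>x\<close>. Sharing a nonzero lower bound with every atom thus says that this root is onto,
  and the open mapping theorem makes it invertible. The abstract algebra offers no space
  \<open>H\<close>: the Peirce 1/2-space of \<open>p\<close> stands in for the orthogonal complement
  of \<xi>, and Baire's theorem is applied directly where open mapping would be. The obstacle is
  uniformity: in infinite dimension the multiples found atom by atom could tend to 0. The test
  speaks only of effects, order and 0, since an order isomorphism of effects is not given to respect
  sums, scalars or projections. Square roots come from a norm-convergent iteration, and projections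
  arise as maximal effects: \<open>2 m - m^2\<close> lies above \<open>m\<close>, so maximality
  forces \<open>m^2 = m\<close>.\<close>

locale JB_unit = JB_algebra jp for jp :: "'a::banach \<Rightarrow> 'a \<Rightarrow> 'a" (infixl "\<odot>" 70) +
  fixes e :: 'a
  assumes unit: "e \<odot> x = x"
begin

section \<open>Bilinear calculus and polarization of the Jordan identity\<close>

lemma jp_add_left: "(x + y) \<odot> z = x \<odot> z + y \<odot> z"
  and jp_add_right: "z \<odot> (x + y) = z \<odot> x + z \<odot> y"
  and jp_diff_left: "(x - y) \<odot> z = x \<odot> z - y \<odot> z"
  and jp_diff_right: "z \<odot> (x - y) = z \<odot> x - z \<odot> y"
  and jp_scale_left: "(c *\<^sub>R x) \<odot> z = c *\<^sub>R (x \<odot> z)"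
  and jp_scale_right: "z \<odot> (c *\<^sub>R x) = c *\<^sub>R (z \<odot> x)"
  and jp_minus_left: "(- x) \<odot> z = - (x \<odot> z)"
  and jp_minus_right: "z \<odot> (- x) = - (z \<odot> x)"
  and jp_zero_left: "0 \<odot> z = 0"
  and jp_zero_right: "z \<odot> 0 = 0"
  using bilinear
  by (auto simp: bilinear_ladd bilinear_radd bilinear_lsub bilinear_rsub bilinear_lmul bilinear_rmul
      bilinear_lneg bilinear_rneg bilinear_lzero bilinear_rzero)

lemmas jp_linear = jp_add_left jp_add_right jp_diff_left jp_diff_right jp_scale_left jp_scale_right
  jp_minus_left jp_minus_right jp_zero_left jp_zero_right

lemma unit_right: "x \<odot> e = x"
  using unit commute by metis

lemma bounded_bilinear_jp: "bounded_bilinear (\<odot>)"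
  by (rule bounded_bilinear.intro)
    (auto simp: jp_linear intro!: exI[of _ 1] norm_prod)

lemmas jp_continuous_intros = bounded_bilinear.continuous_on[OF bounded_bilinear_jp]
lemmas jp_tendsto = bounded_bilinear.tendsto[OF bounded_bilinear_jp]

lemma norm_e_le: "norm e \<le> 1"
  using norm_square[of e] unit[of e] by (auto simp: power2_eq_square)

lemma square_eq_0_iff: "x \<odot> x = 0 \<longleftrightarrow> x = 0"
  using norm_square[of x] by (auto simp: jp_linear)

lemma square_add: "(x + y) \<odot> (x + y) = x \<odot> x + 2 *\<^sub>R (x \<odot> y) + y \<odot> y"
  by (simp add: jp_linear commute[of y x] scaleR_2)

text \<open>Polarization: the cubic map given by the defect in the Jordan identity vanishes on the
  diagonal, hence so does its symmetrized trilinear form.\<close>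

lemma jordan_linearized:
  "(x \<odot> y) \<odot> (z \<odot> w) + (z \<odot> y) \<odot> (x \<odot> w) + (w \<odot> y) \<odot> (x \<odot> z)
   = x \<odot> (y \<odot> (z \<odot> w)) + z \<odot> (y \<odot> (x \<odot> w)) + w \<odot> (y \<odot> (x \<odot> z))"
  (is "?L = ?R")
proof -
  define T where "T a b c = a \<odot> (y \<odot> (b \<odot> c)) - (a \<odot> y) \<odot> (b \<odot> c)" for a b c
  have T0: "T a a a = 0" for a
    unfolding T_def using jordan[of a y] by simp
  have Tadd: "T (a + a') b c = T a b c + T a' b c" "T a (b + b') c = T a b c + T a b' c"
    "T a b (c + c') = T a b c + T a b c'" for a a' b b' c c'
    by (simp_all add: T_def jp_linear)
  have Tc: "T a b c = T a c b" for a b c by (simp add: T_def commute[of b c])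
  \<comment> \<open>Inclusion-exclusion over the cubes leaves the terms in which all three variables
    occur; symmetry of \<open>T\<close> in its last two arguments pairs these six into twice
    three.\<close>
  have "T (x+z+w) (x+z+w) (x+z+w) - T (x+z) (x+z) (x+z) - T (x+w) (x+w) (x+w) - T (z+w) (z+w) (z+w)
     + T x x x + T z z z + T w w w = 2 *\<^sub>R (T x z w + T z x w + T w x z)"
    by (simp add: Tadd Tc[of x w z] Tc[of z w x] Tc[of w z x] algebra_simps scaleR_2)
  then have "T x z w + T z x w + T w x z = 0"
    by (simp add: T0)
  then show ?thesis
    by (simp add: T_def algebra_simps)
qed

text \<open>With \<open>w\<close> innermost or rightmost everywhere, the identity becomes a relation
  between multiplication operators applied to \<open>w\<close>.\<close>

lemma jordan_linearized':
  "(x \<odot> y) \<odot> (z \<odot> w) + (z \<odot> y) \<odot> (x \<odot> w) + (x \<odot> z) \<odot> (y \<odot> w)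
   = x \<odot> (y \<odot> (z \<odot> w)) + z \<odot> (y \<odot> (x \<odot> w)) + (y \<odot> (x \<odot> z)) \<odot> w"
  using jordan_linearized[of x y z w] by (simp add: commute)

section \<open>Square roots and the positive cone\<close>

text \<open>A fixed point \<open>l\<close> of the map sending \<open>v\<close> to
  \<open>(u + v^2)/2\<close> satisfies \<open>(e - l)^2 = e - u\<close>. On the unit ball this map
  need not be a strict contraction when \<open>norm u = 1\<close>; convergence follows by majorizing
  with \<open>r\<close>, the same iteration for the scalar 1. The last conclusion lets roots be
  taken inside any closed unital subalgebra that contains \<open>u\<close>.\<close>

lemma square_root_exists:
  assumes u: "norm u \<le> 1"
  obtains s where "s \<odot> s = e - u" "norm (e - s) \<le> 1"
    "\<And>S. jb_subalgebra (\<odot>) S \<Longrightarrow> u \<in> S \<Longrightarrow> e \<in> S \<Longrightarrow> s \<in> S"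
proof -
  define r :: "nat \<Rightarrow> real" where "r = rec_nat 0 (\<lambda>_ t. (1 + t\<^sup>2) / 2)"
  define y where "y = rec_nat 0 (\<lambda>_ v. (1/2) *\<^sub>R (u + v \<odot> v))"
  have r0: "r 0 = 0" and rS: "r (Suc n) = (1 + (r n)\<^sup>2) / 2" for n by (simp_all add: r_def)
  have y0: "y 0 = 0" and yS: "y (Suc n) = (1/2) *\<^sub>R (u + y n \<odot> y n)" for n by (simp_all add: y_def)
  have r01: "0 \<le> r n \<and> r n \<le> 1" for n
  proof (induction n)
    case (Suc n)
    then have "(r n)\<^sup>2 \<le> 1" by (simp add: power_le_one)
    then show ?case by (simp add: rS)
  qed (simp add: r0)
  have yr: "norm (y n) \<le> r n" for n
  proof (induction n)
    case (Suc n)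
    have "norm (u + y n \<odot> y n) \<le> 1 + (r n)\<^sup>2"
      using u Suc norm_square[of "y n"] power_mono[OF Suc, of 2] norm_triangle_ineq[of u "y n \<odot> y n"] by simp
    then show ?case by (simp add: yS rS)
  qed (simp add: y0 r0)
  have step: "norm (y (Suc n) - y n) \<le> r (Suc n) - r n" for n
  proof (induction n)
    case 0 then show ?case using u by (simp add: y0 yS r0 rS jp_linear)
  next
    case (Suc n)
    \<comment> \<open>A difference of two squares factors by commutativity alone; the same
      factorization for \<open>r\<close> closes the induction.\<close>
    have eq: "y (Suc (Suc n)) - y (Suc n) = (1/2) *\<^sub>R ((y (Suc n) - y n) \<odot> (y (Suc n) + y n))"
      by (simp only: yS[of "Suc n"] yS[of n])
        (simp add: jp_linear commute algebra_simps)
    have "norm ((y (Suc n) - y n) \<odot> (y (Suc n) + y n)) \<le> (r (Suc n) - r n) * (r (Suc n) + r n)"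
      using norm_triangle_ineq[of "y (Suc n)" "y n"] yr[of n] yr[of "Suc n"] Suc
        norm_ge_zero[of "y (Suc n) - y n"]
      by (intro order.trans[OF norm_prod mult_mono]) (rule norm_ge_zero | linarith)+
    then have "norm (y (Suc (Suc n)) - y (Suc n)) \<le> (r (Suc n) - r n) * (r (Suc n) + r n) / 2"
      by (simp add: eq)
    also have "\<dots> = r (Suc (Suc n)) - r (Suc n)"
      by (subst rS, subst (3) rS) (simp add: field_simps power2_eq_square)
    finally show ?case .
  qed
  have "r n \<le> r (Suc n)" for n
    using step[of n] norm_ge_zero[of "y (Suc n) - y n"] by linarith
  then have "monoseq r" by (simp add: incseq_SucI incseq_imp_monoseq)
  moreover have "Bseq r" by (rule BseqI'[of _ 1]) (use r01 in auto)
  ultimately obtain c where "r \<longlonglongrightarrow> c"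
    using Bseq_monoseq_convergent convergent_def by blast
  then have rs: "summable (\<lambda>n. r (Suc n) - r n)"
    by (rule telescope_summable)
  have "summable (\<lambda>n. y (Suc n) - y n)"
    by (rule summable_comparison_test'[OF rs]) (use step in simp)
  then have "convergent (\<lambda>n. \<Sum>k<n. y (Suc k) - y k)"
    by (simp add: summable_iff_convergent)
  then have "convergent y" by (simp add: sum_lessThan_telescope y0)
  then obtain l where l: "y \<longlonglongrightarrow> l" by (auto simp: convergent_def)
  have "(\<lambda>n. (1/2) *\<^sub>R (u + y n \<odot> y n)) \<longlonglongrightarrow> (1/2) *\<^sub>R (u + l \<odot> l)"
    by (intro tendsto_intros jp_tendsto l)
  moreover have "(\<lambda>n. (1/2) *\<^sub>R (u + y n \<odot> y n)) \<longlonglongrightarrow> l"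
    using LIMSEQ_Suc[OF l] by (simp add: yS)
  ultimately have leq: "(1/2) *\<^sub>R (u + l \<odot> l) = l" by (rule LIMSEQ_unique)
  show ?thesis
  proof
    have "u + l \<odot> l = 2 *\<^sub>R ((1/2) *\<^sub>R (u + l \<odot> l))" by simp
    then have "u + l \<odot> l = 2 *\<^sub>R l" by (simp only: leq)
    then have "l \<odot> l = 2 *\<^sub>R l - u" by (simp add: algebra_simps)
    then show "(e - l) \<odot> (e - l) = e - u"
      by (simp add: jp_linear unit unit_right scaleR_2)
    show "norm (e - (e - l)) \<le> 1"
      using LIMSEQ_le_const2[OF tendsto_norm[OF l], of 1] order.trans[OF yr] r01 by simp
    fix S assume S: "jb_subalgebra (\<odot>) S" "u \<in> S" "e \<in> S"
    then have sub: "subspace S" "closed S" "\<And>x y. x \<in> S \<Longrightarrow> y \<in> S \<Longrightarrow> x \<odot> y \<in> S"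
      by (auto simp: jb_subalgebra_def)
    have "y n \<in> S" for n
      by (induction n) (auto simp: y0 yS intro!: subspace_scale subspace_add subspace_0 sub S)
    then have "l \<in> S" using sub(2) l closed_sequentially by blast
    then show "e - l \<in> S" using S sub by (auto intro: subspace_diff)
  qed
qed

definition pos :: "'a \<Rightarrow> bool" where "pos a \<longleftrightarrow> (\<exists>z. a = z \<odot> z)"

lemma pos_square: "pos (z \<odot> z)" by (auto simp: pos_def)

lemma jb_le_iff: "jb_le (\<odot>) x y \<longleftrightarrow> pos (y - x)"
  by (simp add: jb_le_def pos_def)

lemma pos_0: "pos 0" by (metis pos_square jp_zero_left)

lemma pos_e: "pos e" by (metis pos_square unit)

lemma pos_scale: assumes "pos a" "c \<ge> 0" shows "pos (c *\<^sub>R a)"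
proof -
  obtain z where "a = z \<odot> z" using assms by (auto simp: pos_def)
  then have "c *\<^sub>R a = (sqrt c *\<^sub>R z) \<odot> (sqrt c *\<^sub>R z)" using assms by (simp add: jp_linear)
  then show ?thesis by (auto simp: pos_def)
qed

lemma pos_root:
  assumes "norm (r *\<^sub>R e - a) \<le> r"
  obtains s where "a = s \<odot> s" "pos s"
    "\<And>S. jb_subalgebra (\<odot>) S \<Longrightarrow> a \<in> S \<Longrightarrow> e \<in> S \<Longrightarrow> s \<in> S"
proof (cases "r = 0")
  case True
  then have "a = 0" using assms by simp
  then show ?thesis using that[of 0] by (auto simp: jp_linear pos_0 jb_subalgebra_def subspace_0)
next
  case False
  then have r: "r > 0" using assms norm_ge_zero order.trans by (metis order_le_less)
  have root: "\<exists>s. (1/r) *\<^sub>R a = s \<odot> s \<and> norm (e - s) \<le> 1 \<and>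
      (\<forall>S. jb_subalgebra (\<odot>) S \<longrightarrow> a \<in> S \<longrightarrow> e \<in> S \<longrightarrow> s \<in> S)"
    if "norm (r *\<^sub>R e - a) \<le> r" "r > 0" for r a
  proof -
    have eq: "e - (1/r) *\<^sub>R a = (1/r) *\<^sub>R (r *\<^sub>R e - a)" using that by (simp add: algebra_simps)
    have "norm (e - (1/r) *\<^sub>R a) \<le> 1" unfolding eq norm_scaleR using that by simp
    then obtain s where s: "s \<odot> s = e - (e - (1/r) *\<^sub>R a)" "norm (e - s) \<le> 1"
      "\<And>S. jb_subalgebra (\<odot>) S \<Longrightarrow> e - (1/r) *\<^sub>R a \<in> S \<Longrightarrow> e \<in> S \<Longrightarrow> s \<in> S"
      by (rule square_root_exists) blast
    have "s \<in> S" if "jb_subalgebra (\<odot>) S" "a \<in> S" "e \<in> S" for S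
      using that s(3)[of S] by (auto simp: jb_subalgebra_def intro!: subspace_diff subspace_scale)
    then show ?thesis using s by (intro exI[of _ s]) auto
  qed
  obtain s where s: "(1/r) *\<^sub>R a = s \<odot> s" "norm (e - s) \<le> 1"
      "\<And>S. jb_subalgebra (\<odot>) S \<Longrightarrow> a \<in> S \<Longrightarrow> e \<in> S \<Longrightarrow> s \<in> S"
    using root[OF assms r] by blast
  \<comment> \<open>The bound on \<open>e - s\<close> is the hypothesis of \<open>root\<close> with
    radius 1, so the root is itself a square.\<close>
  have "\<exists>c. s = c \<odot> c" using root[of 1 s] s(2) by auto
  then have "pos s" by (auto simp: pos_def)
  show ?thesis
  proof (rule that)
    have "a = r *\<^sub>R (s \<odot> s)" using r by (simp flip: s(1))
    then show "a = (sqrt r *\<^sub>R s) \<odot> (sqrt r *\<^sub>R s)" using r by (simp add: jp_linear)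
    show "pos (sqrt r *\<^sub>R s)" using \<open>pos s\<close> r by (simp add: pos_scale)
    show "sqrt r *\<^sub>R s \<in> S" if "jb_subalgebra (\<odot>) S" "a \<in> S" "e \<in> S" for S
      using s(3)[OF that] that by (auto simp: jb_subalgebra_def intro!: subspace_scale)
  qed
qed

text \<open>Being a square becomes a ball condition. Convexity and closedness of the cone and the
  compactness of order intervals are all read off from it.\<close>

lemma pos_iff:
  assumes "norm a \<le> r"
  shows "pos a \<longleftrightarrow> norm (r *\<^sub>R e - a) \<le> r"
proof
  assume "norm (r *\<^sub>R e - a) \<le> r"
  then show "pos a" by (rule pos_root) (simp add: pos_square)
next
  assume "pos a"
  then obtain z where z: "a = z \<odot> z" by (auto simp: pos_def)
  show "norm (r *\<^sub>R e - a) \<le> r"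
  proof (cases "r = 0")
    case False
    then have r: "r > 0" using assms norm_ge_zero order.trans by (metis order_le_less)
    have "norm ((1/r) *\<^sub>R a) \<le> 1" using assms r by (simp add: field_simps)
    then obtain c where c: "c \<odot> c = e - (1/r) *\<^sub>R a" by (rule square_root_exists) blast
    let ?z = "sqrt (1/r) *\<^sub>R z"
    have "?z \<odot> ?z = (1/r) *\<^sub>R a" using r by (simp add: jp_linear z)
    \<comment> \<open>The squares of \<open>c\<close> and of the rescaled \<open>z\<close> add up to
      \<open>e\<close>, so the axiom on sums of squares bounds the first by
      \<open>norm e\<close>.\<close>
    then have "norm (c \<odot> c) \<le> norm e" using norm_square_add[of c ?z] by (simp add: c)
    then have "norm (e - (1/r) *\<^sub>R a) \<le> 1" using norm_e_le by (simp add: c)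
    moreover have "r *\<^sub>R e - a = r *\<^sub>R (e - (1/r) *\<^sub>R a)" using r by (simp add: algebra_simps)
    ultimately show ?thesis using r by simp
  qed (use assms in simp)
qed

lemma pos_square_root:
  assumes "pos a"
  obtains s where "a = s \<odot> s" "pos s"
    "\<And>S. jb_subalgebra (\<odot>) S \<Longrightarrow> a \<in> S \<Longrightarrow> e \<in> S \<Longrightarrow> s \<in> S"
  using assms pos_iff[of a "norm a"] pos_root by (metis order_refl)

lemma pos_add: assumes "pos a" "pos b" shows "pos (a + b)"
proof -
  have "norm (norm a *\<^sub>R e - a) \<le> norm a" "norm (norm b *\<^sub>R e - b) \<le> norm b"
    using assms pos_iff by auto
  moreover have eq: "(norm a + norm b) *\<^sub>R e - (a + b) = (norm a *\<^sub>R e - a) + (norm b *\<^sub>R e - b)"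
    by (simp add: algebra_simps)
  ultimately have "norm ((norm a + norm b) *\<^sub>R e - (a + b)) \<le> norm a + norm b"
    unfolding eq using norm_triangle_ineq[of "norm a *\<^sub>R e - a" "norm b *\<^sub>R e - b"] by linarith
  then show ?thesis using pos_iff[OF norm_triangle_ineq] by blast
qed

lemma pos_trans: "pos (b - a) \<Longrightarrow> pos (c - b) \<Longrightarrow> pos (c - a)"
  using pos_add[of "b - a" "c - b"] by simp

lemma pos_antisym: assumes "pos a" "pos (- a)" shows "a = 0"
proof -
  obtain z w where zw: "a = z \<odot> z" "- a = w \<odot> w" using assms by (auto simp: pos_def)
  have "norm (z \<odot> z) \<le> 0" using norm_square_add[of z w] by (simp flip: zw)
  then show ?thesis by (simp add: zw)
qed

lemma pos_add_eq_0: assumes "pos a" "pos b" "a + b = 0" shows "a = 0"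
  using assms pos_antisym[of a] by (simp add: eq_neg_iff_add_eq_0[symmetric] minus_equation_iff)

lemma pos_norm_e_minus: "norm a \<le> r \<Longrightarrow> pos (r *\<^sub>R e - a)"
proof -
  assume "norm a \<le> r"
  then show ?thesis using pos_root[of r "r *\<^sub>R e - a"] pos_square by (metis diff_diff_eq2 add_diff_cancel_left')
qed

lemma closed_pos: "closed {a. pos a}"
proof -
  have "{a. pos a} = {a. norm (norm a *\<^sub>R e - a) \<le> norm a}" using pos_iff by auto
  then show ?thesis by (auto intro!: closed_Collect_le continuous_intros)
qed

lemma pos_limit:
  assumes "X \<longlonglongrightarrow> a" "\<And>n::nat. pos (X n)" shows "pos a"
  using closed_sequentially[OF closed_pos, of X a] assms by simp

section \<open>Singly generated subalgebras\<close>

primrec jpow :: "'a \<Rightarrow> nat \<Rightarrow> 'a" where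
  "jpow x 0 = e"
| "jpow x (Suc n) = x \<odot> jpow x n"

text \<open>The operator form of the Jordan identity expresses multiplication by
  \<open>x^(n+2)\<close> through multiplications by \<open>x\<close>, \<open>x^2\<close>,
  \<open>x^n\<close> and \<open>x^(n+1)\<close>. The induction therefore carries two consecutive
  powers.\<close>

lemma jpow_commutes:
  assumes add: "\<And>u v. T (u + v) = T u + T v" and T1: "\<And>u. T (x \<odot> u) = x \<odot> T u"
    and T2: "\<And>u. T ((x \<odot> x) \<odot> u) = (x \<odot> x) \<odot> T u"
  shows "T (jpow x n \<odot> w) = jpow x n \<odot> T w"
proof -
  have sub: "T (u - v) = T u - T v" for u v
    using add[of "u - v" v] by simp
  have "(\<forall>w. T (jpow x n \<odot> w) = jpow x n \<odot> T w) \<and> (\<forall>w. T (jpow x (Suc n) \<odot> w) = jpow x (Suc n) \<odot> T w)"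
  proof (induction n)
    case 0
    then show ?case by (simp add: unit unit_right T1)
  next
    case (Suc n)
    let ?z = "jpow x n"
    have rec: "jpow x (Suc (Suc n)) \<odot> w = (x \<odot> x) \<odot> (?z \<odot> w) + jpow x (Suc n) \<odot> (x \<odot> w)
        + jpow x (Suc n) \<odot> (x \<odot> w) - x \<odot> (x \<odot> (?z \<odot> w)) - ?z \<odot> (x \<odot> (x \<odot> w))" for w
      using jordan_linearized'[of x x ?z w] by (simp add: commute[of ?z x] algebra_simps)
    have "T (jpow x (Suc (Suc n)) \<odot> w) = jpow x (Suc (Suc n)) \<odot> T w" for w
      unfolding rec using Suc by (simp add: add sub T1 T2 del: jpow.simps)
    then show ?case using Suc by blast
  qed
  then show ?thesis by blast
qed

lemma jpow_jpow_commute: "jpow x m \<odot> (jpow x n \<odot> w) = jpow x n \<odot> (jpow x m \<odot> w)"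
proof (rule jpow_commutes)
  have sq: "x \<odot> ((x \<odot> x) \<odot> u) = (x \<odot> x) \<odot> (x \<odot> u)" for u
    using jordan[of x u] by (simp add: commute)
  show "jpow x m \<odot> (x \<odot> u) = x \<odot> (jpow x m \<odot> u)" for u
    by (rule jpow_commutes[symmetric]) (simp_all add: jp_linear sq)
  show "jpow x m \<odot> ((x \<odot> x) \<odot> u) = (x \<odot> x) \<odot> (jpow x m \<odot> u)" for u
    by (rule jpow_commutes[symmetric]) (simp_all add: jp_linear sq)
qed (simp add: jp_linear)

lemma jpow_mult: "jpow x m \<odot> jpow x n = jpow x (m + n)"
proof (induction n)
  case (Suc n)
  then show ?case
    using jpow_jpow_commute[of x m 1 "jpow x n"] by (simp add: unit_right)
qed (simp add: unit_right)

text \<open>A closure of polynomials instead of a hull: identities checked on powers extend to it by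
  linearity and continuity.\<close>

definition alg :: "'a \<Rightarrow> 'a set" where
  "alg x = closure (span (range (jpow x)))"

lemma alg_induct_closed:
  assumes "subspace P" "closed P" "\<And>n. jpow x n \<in> P"
  shows "alg x \<subseteq> P"
  unfolding alg_def using assms by (intro closure_minimal span_minimal) auto

lemma jpow_in_alg: "jpow x n \<in> alg x"
  unfolding alg_def by (meson closure_subset span_base rangeI subsetD)

lemma alg_self: "x \<in> alg x" and alg_e: "e \<in> alg x"
  using jpow_in_alg[of x 1] jpow_in_alg[of x 0] by (simp_all add: unit_right)

lemma subspace_alg: "subspace (alg x)" and closed_alg: "closed (alg x)"
proof -
  let ?S = "span (range (jpow x))"
  have "u + v \<in> closure ?S" if uv: "u \<in> closure ?S" "v \<in> closure ?S" for u v
  proof -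
    obtain f g where "\<forall>n. f n \<in> ?S" "f \<longlonglongrightarrow> u" "\<forall>n. g n \<in> ?S" "g \<longlonglongrightarrow> v"
      using uv unfolding closure_sequential by blast
    then have "\<forall>n. f n + g n \<in> ?S" "(\<lambda>n. f n + g n) \<longlonglongrightarrow> u + v"
      by (auto intro: span_add tendsto_add)
    then show ?thesis unfolding closure_sequential by (intro exI[of _ "\<lambda>n. f n + g n"] conjI)
  qed
  moreover have "c *\<^sub>R u \<in> closure ?S" if u: "u \<in> closure ?S" for u c
  proof -
    obtain f where "\<forall>n. f n \<in> ?S" "f \<longlonglongrightarrow> u"
      using u unfolding closure_sequential by blast
    then have "\<forall>n. c *\<^sub>R f n \<in> ?S" "(\<lambda>n. c *\<^sub>R f n) \<longlonglongrightarrow> c *\<^sub>R u"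
      by (auto intro: span_scale tendsto_scaleR)
    then show ?thesis unfolding closure_sequential by (intro exI[of _ "\<lambda>n. c *\<^sub>R f n"] conjI)
  qed
  ultimately show "subspace (alg x)"
    using closure_subset[of ?S] span_zero[of "range (jpow x)"] by (auto simp: alg_def subspace_def)
qed (simp add: alg_def)

lemma alg_commute:
  assumes a: "a \<in> alg x" and b: "b \<in> alg x" shows "a \<odot> (b \<odot> w) = b \<odot> (a \<odot> w)"
proof -
  have cl: "subspace {c. \<forall>w. c \<odot> (d \<odot> w) = d \<odot> (c \<odot> w)}"
    "closed {c. \<forall>w. c \<odot> (d \<odot> w) = d \<odot> (c \<odot> w)}" for d
    by (auto simp: subspace_def jp_linear
        intro!: closed_Collect_all closed_Collect_eq jp_continuous_intros continuous_intros)
  have "alg x \<subseteq> {c. \<forall>w. c \<odot> (jpow x n \<odot> w) = jpow x n \<odot> (c \<odot> w)}" for n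
    by (rule alg_induct_closed[OF cl]) (simp add: jpow_jpow_commute)
  from subsetD[OF this b] have b': "b \<odot> (jpow x n \<odot> w) = jpow x n \<odot> (b \<odot> w)" for n w
    by simp
  have "alg x \<subseteq> {c. \<forall>w. c \<odot> (b \<odot> w) = b \<odot> (c \<odot> w)}"
    by (rule alg_induct_closed[OF cl]) (simp add: b')
  then show ?thesis using a by blast
qed

lemma jb_subalgebra_alg: "jb_subalgebra (\<odot>) (alg x)"
proof -
  have cl: "subspace {c. c \<odot> d \<in> alg x}" "closed {c. c \<odot> d \<in> alg x}" for d
  proof -
    have "closed ((\<lambda>c. c \<odot> d) -` alg x)"
      by (intro closed_vimage closed_alg jp_continuous_intros continuous_intros)
    then show "closed {c. c \<odot> d \<in> alg x}" by (simp add: vimage_def)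
    show "subspace {c. c \<odot> d \<in> alg x}"
      using subspace_alg[of x] by (auto simp: subspace_def jp_linear)
  qed
  have "alg x \<subseteq> {c. c \<odot> jpow x n \<in> alg x}" for n
    by (rule alg_induct_closed[OF cl]) (simp add: jpow_mult jpow_in_alg)
  then have "alg x \<subseteq> {c. c \<odot> b \<in> alg x}" if "b \<in> alg x" for b
    using that by (intro alg_induct_closed[OF cl]) (auto simp: commute)
  then show ?thesis
    using subspace_alg closed_alg by (auto simp: jb_subalgebra_def)
qed

lemma alg_closed:
  "a \<in> alg x \<Longrightarrow> b \<in> alg x \<Longrightarrow> a \<odot> b \<in> alg x"
  "a \<in> alg x \<Longrightarrow> b \<in> alg x \<Longrightarrow> a + b \<in> alg x"
  "a \<in> alg x \<Longrightarrow> b \<in> alg x \<Longrightarrow> a - b \<in> alg x"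
  "a \<in> alg x \<Longrightarrow> c *\<^sub>R a \<in> alg x"
  using jb_subalgebra_alg[of x]
  by (auto simp: jb_subalgebra_def subspace_add subspace_diff subspace_scale)

text \<open>This is commutation of the two multiplication operators, applied to the middle factor;
  \<open>b\<close> is therefore arbitrary.\<close>

lemma alg_assoc:
  assumes "a \<in> alg x" "c \<in> alg x" shows "a \<odot> (b \<odot> c) = (a \<odot> b) \<odot> c"
  using alg_commute[OF assms, of b] by (simp only: commute[of b c] commute[of "a \<odot> b" c])

lemma alg_root:
  assumes "pos a" "a \<in> alg x"
  obtains s where "a = s \<odot> s" "s \<in> alg x" "pos s"
  proof (rule pos_square_root[OF assms(1)])
  fix s assume "a = s \<odot> s" "pos s" "\<And>S. jb_subalgebra (\<odot>) S \<Longrightarrow> a \<in> S \<Longrightarrow> e \<in> S \<Longrightarrow> s \<in> S"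
  then show thesis using that[of s] assms(2) alg_e jb_subalgebra_alg by blast
qed

lemma alg_square_mult:
  assumes "a \<in> alg x" "b \<in> alg x" shows "(a \<odot> a) \<odot> (b \<odot> b) = (a \<odot> b) \<odot> (a \<odot> b)"
proof -
  have "(a \<odot> a) \<odot> (b \<odot> b) = a \<odot> (a \<odot> (b \<odot> b))"
    using alg_assoc[of a x "b \<odot> b" a] alg_closed(1)[OF assms(2,2)] assms by simp
  also have "\<dots> = a \<odot> ((a \<odot> b) \<odot> b)" by (simp only: alg_assoc[OF assms, of b])
  also have "\<dots> = (a \<odot> b) \<odot> (a \<odot> b)" 
    by (rule alg_commute[OF assms(1) alg_closed(1)[OF assms]])
  finally show ?thesis .
qed

lemma alg_pos_mult:
  assumes "pos a" "a \<in> alg x" "pos b" "b \<in> alg x" shows "pos (a \<odot> b)"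
proof -
  obtain s where s: "a = s \<odot> s" "s \<in> alg x" using alg_root[OF assms(1,2)] by blast
  obtain t where t: "b = t \<odot> t" "t \<in> alg x" using alg_root[OF assms(3,4)] by blast
  show ?thesis by (simp add: s(1) t(1) alg_square_mult[OF s(2) t(2)] pos_square)
qed

text \<open>Inside \<open>alg a\<close> the product \<open>(r e - a)(r e + a)\<close> is a square,
  so \<open>a^2\<close> plus a square equals \<open>r^2 e\<close>, and the axiom on sums of squares
  bounds \<open>norm (a^2)\<close>.\<close>

lemma pos_norm_le:
  assumes "pos (r *\<^sub>R e - a)" "pos (r *\<^sub>R e + a)" "r \<ge> 0" shows "norm a \<le> r"
proof -
  have *: "r *\<^sub>R e - a \<in> alg a" "r *\<^sub>R e + a \<in> alg a"
    by (simp_all add: alg_closed alg_self alg_e)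
  obtain s where s: "r *\<^sub>R e - a = s \<odot> s" "s \<in> alg a" using alg_root[OF assms(1) *(1)] by blast
  obtain t where t: "r *\<^sub>R e + a = t \<odot> t" "t \<in> alg a" using alg_root[OF assms(2) *(2)] by blast
  have "(r *\<^sub>R e - a) \<odot> (r *\<^sub>R e + a) = (s \<odot> t) \<odot> (s \<odot> t)"
    using alg_square_mult[OF s(2) t(2)] by (simp only: s(1) t(1))
  then have "a \<odot> a + (s \<odot> t) \<odot> (s \<odot> t) = (r * r) *\<^sub>R e"
    by (simp add: jp_linear unit unit_right algebra_simps)
  then have "norm (a \<odot> a) \<le> r * r * norm e"
    using norm_square_add[of a "s \<odot> t"] by simp
  also have "\<dots> \<le> r * r * 1" using norm_e_le by (intro mult_left_mono) auto
  finally show ?thesis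
    using assms(3) by (simp add: norm_square power2_eq_square[symmetric])
qed

lemma pos_norm_mono: assumes "pos a" "pos (r *\<^sub>R e - a)" "r \<ge> 0" shows "norm a \<le> r"
  using pos_norm_le[OF assms(2) _ assms(3)] pos_add[OF pos_scale[OF pos_e assms(3)] assms(1)] by simp

lemma square_le_norm: assumes "pos b" shows "pos (norm b *\<^sub>R b - b \<odot> b)"
proof -
  have "pos (b \<odot> (norm b *\<^sub>R e - b))"
    using assms pos_norm_e_minus[of b "norm b"] alg_self alg_e alg_closed
    by (intro alg_pos_mult[of _ b]) auto
  then show ?thesis by (simp add: jp_linear unit_right)
qed

lemma square_le_self: assumes b: "pos b" "norm b \<le> 1" shows "pos (b - b \<odot> b)"
proof -
  have "pos (norm b *\<^sub>R b - b \<odot> b + (1 - norm b) *\<^sub>R b)"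
    using b by (intro pos_add pos_scale square_le_norm) auto
  then show ?thesis by (simp add: algebra_simps)
qed

text \<open>Rescales any square into an effect; the summand 1 avoids dividing by zero.\<close>

lemma normalized_square:
  defines "t z \<equiv> (1 / (norm (z \<odot> z) + 1)) *\<^sub>R (z \<odot> z)"
  shows "pos (t z)" "pos (e - t z)"
proof -
  have n: "norm (z \<odot> z) + 1 > 0" by (rule add_nonneg_pos) simp_all
  then show "pos (t z)" unfolding t_def by (intro pos_scale pos_square) simp
  have "norm (t z) \<le> 1" using n by (simp add: t_def)
  then show "pos (e - t z)" using pos_norm_e_minus[of "t z" 1] by simp
qed

section \<open>Invertibility as a lower bound by a multiple of the unit\<close>

lemma jb_invertible_imp:
  assumes "jb_invertible (\<odot>) e x" "pos x"
  obtains c where "c > 0" "pos (x - c *\<^sub>R e)"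
proof -
  obtain y where y: "y \<in> jb_subalgebra (\<odot>) hull {x, e}" "x \<odot> y = e"
    using assms by (auto simp: jb_invertible_def)
  have "jb_subalgebra (\<odot>) hull {x, e} \<subseteq> alg x"
    by (rule hull_minimal) (simp_all add: alg_self alg_e jb_subalgebra_alg)
  then have ya: "y \<in> alg x" using y by blast
  define n where "n = norm y + 1"
  have n: "n > 0" by (simp add: n_def add_nonneg_pos)
  \<comment> \<open>Multiplying by \<open>x\<close> within the associative \<open>alg x\<close>
    turns the upper bound \<open>n\<close> on the inverse into the lower bound \<open>1/n\<close> on
    \<open>x\<close>.\<close>
  have "pos (n *\<^sub>R e - y)" by (rule pos_norm_e_minus) (simp add: n_def)
  then have "pos (x \<odot> (n *\<^sub>R e - y))"
    using assms(2) ya by (intro alg_pos_mult[of _ x]) (simp_all add: alg_self alg_closed alg_e)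
  then have "pos (n *\<^sub>R x - e)" by (simp add: jp_linear y unit_right)
  then have "pos ((1/n) *\<^sub>R (n *\<^sub>R x - e))" using n by (intro pos_scale) auto
  then have "pos (x - (1/n) *\<^sub>R e)" using n by (simp add: algebra_simps)
  then show ?thesis using n that[of "1/n"] by simp
qed

text \<open>The Neumann series of \<open>e - (e - x)\<close>, phrased as the fixed point of
  \<open>y = e + (e - x) y\<close>. Running the contraction in the complete generated subalgebra
  places the inverse there. Capping \<open>c\<close> at 1 keeps the factor \<open>1 - c'\<close> in
  \<open>[0,1)\<close>.\<close>

lemma jb_invertible_if:
  assumes c: "c > 0" "pos (x - c *\<^sub>R e)" and x1: "pos (e - x)"
  shows "jb_invertible (\<odot>) e x"
proof -
  define c' where "c' = min c 1"
  have c': "0 < c'" "c' \<le> 1" using c by (auto simp: c'_def)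
  have "pos ((x - c *\<^sub>R e) + (c - c') *\<^sub>R e)"
    using c by (intro pos_add pos_scale pos_e) (auto simp: c'_def)
  then have "pos (x - c' *\<^sub>R e)" by (simp add: algebra_simps)
  then have "norm (e - x) \<le> 1 - c'"
    using c' x1 by (intro pos_norm_mono) (auto simp: algebra_simps)
  define u where "u = e - x"
  define S where "S = jb_subalgebra (\<odot>) hull {x, e}"
  have S: "jb_subalgebra (\<odot>) S" unfolding S_def
    by (rule hull_in) (auto simp: jb_subalgebra_def intro: subspace_Inter)
  have xS: "x \<in> S" "e \<in> S" unfolding S_def using hull_subset[of "{x, e}" "jb_subalgebra (\<odot>)"] by auto
  have "\<exists>!y\<in>S. e + u \<odot> y = y"
  proof (rule Banach_fix)
    show "complete S" using S by (simp add: jb_subalgebra_def complete_eq_closed)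
    show "(\<lambda>y. e + u \<odot> y) ` S \<subseteq> S"
      using S xS by (auto simp: jb_subalgebra_def u_def intro!: subspace_add subspace_diff)
    show "dist (e + u \<odot> v) (e + u \<odot> w) \<le> (1 - c') * dist v w" for v w
    proof -
      have "norm (u \<odot> (v - w)) \<le> (1 - c') * norm (v - w)"
        using mult_right_mono[OF \<open>norm (e - x) \<le> 1 - c'\<close> norm_ge_zero[of "v - w"]]
          norm_prod[of u "v - w"] by (simp add: u_def)
      then show ?thesis by (simp add: dist_norm jp_linear)
    qed
  qed (use xS c' in auto)
  then obtain y where y: "y \<in> S" "e + u \<odot> y = y" by blast
  then have "x \<odot> y = e" by (simp add: u_def jp_linear unit)
  then show ?thesis using y by (auto simp: jb_invertible_def S_def)
qed

section \<open>Order estimates for multiplication operators\<close>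

text \<open>Up to an error of second order in \<open>s\<close>, the operator \<open>1 + s w\<close> preserves positivity;
  this replaces the positivity of the group \<open>exp (s w)\<close> of multiplication operators.\<close>
lemma pos_mult_perturb:
  assumes b: "pos b" "norm b \<le> 1"
  shows "pos (b + s *\<^sub>R (w \<odot> b) + (s\<^sup>2 * (norm w)\<^sup>2 / 4) *\<^sub>R e)"
proof -
  have "pos ((b + (s/2) *\<^sub>R w) \<odot> (b + (s/2) *\<^sub>R w))" by (rule pos_square)
  moreover have "pos (b - b \<odot> b)" by (rule square_le_self[OF b])
  moreover have "pos ((s\<^sup>2/4) *\<^sub>R ((norm w)\<^sup>2 *\<^sub>R e - w \<odot> w))"
    by (intro pos_scale pos_norm_e_minus) (simp_all add: norm_square)
  ultimately have "pos ((b + (s/2) *\<^sub>R w) \<odot> (b + (s/2) *\<^sub>R w) + (b - b \<odot> b)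
      + (s\<^sup>2/4) *\<^sub>R ((norm w)\<^sup>2 *\<^sub>R e - w \<odot> w))"
    by (intro pos_add)
  moreover have "(b + (s/2) *\<^sub>R w) \<odot> (b + (s/2) *\<^sub>R w) + (b - b \<odot> b)
      + (s\<^sup>2/4) *\<^sub>R ((norm w)\<^sup>2 *\<^sub>R e - w \<odot> w) = b + s *\<^sub>R (w \<odot> b) + (s\<^sup>2 * (norm w)\<^sup>2 / 4) *\<^sub>R e"
    by (simp add: square_add jp_linear commute[of b w] algebra_simps power2_eq_square)
      (simp flip: scaleR_add_left)
  ultimately show ?thesis by simp
qed

definition is_sup :: "'a set \<Rightarrow> 'a \<Rightarrow> bool" where
  "is_sup A r \<longleftrightarrow> (\<forall>a\<in>A. pos (r - a)) \<and> (\<forall>u. (\<forall>a\<in>A. pos (u - a)) \<longrightarrow> pos (u - r))"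

text \<open>Takes the place of order continuity of multiplication. Perturbing \<open>r - a\<close>
  shows that \<open>r + s (w r) + s^2 K e\<close> is an upper bound of \<open>A\<close>, hence above
  \<open>r\<close>, for both signs of \<open>s\<close>. Dividing by the size of \<open>s\<close> and
  letting it tend to 0 gives both \<open>w r\<close> and \<open>- w r\<close> positive.\<close>

lemma sup_annihilates:
  assumes r: "is_sup A r" and A: "\<And>a. a \<in> A \<Longrightarrow> pos a \<and> w \<odot> a = 0"
    and r1: "pos (e - r)"
  shows "w \<odot> r = 0"
proof -
  define K where "K = (norm w)\<^sup>2 / 4"
  have *: "pos (s *\<^sub>R (w \<odot> r) + (s\<^sup>2 * K) *\<^sub>R e)" for s
  proof -
    have "pos (r + s *\<^sub>R (w \<odot> r) + (s\<^sup>2 * K) *\<^sub>R e - a)" if a: "a \<in> A" for a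
    proof -
      have ra: "pos (r - a)" using r a by (auto simp: is_sup_def)
      have "pos (e - (r - a))" using pos_add[OF r1, of a] A[OF a] by (simp add: algebra_simps)
      then have "norm (r - a) \<le> 1" using pos_norm_mono[OF ra, of 1] by simp
      then show ?thesis
        using pos_mult_perturb[OF ra, of s w] A[OF a] by (simp add: jp_linear K_def algebra_simps)
    qed
    then have "pos (r + s *\<^sub>R (w \<odot> r) + (s\<^sup>2 * K) *\<^sub>R e - r)" using r unfolding is_sup_def by blast
    then show ?thesis by simp
  qed
  have lim: "pos v" if v: "\<And>s. s > 0 \<Longrightarrow> pos (s *\<^sub>R v + (s\<^sup>2 * K) *\<^sub>R e)" for v
  proof (rule pos_limit)
    have vt: "pos (v + (t * K) *\<^sub>R e)" if t: "t > 0" for t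
    proof -
      have "pos ((1/t) *\<^sub>R (t *\<^sub>R v + (t\<^sup>2 * K) *\<^sub>R e))" using t by (intro pos_scale v) auto
      then show ?thesis using t by (simp add: power2_eq_square scaleR_add_right)
    qed
    show "pos (v + (inverse (real (Suc n)) * K) *\<^sub>R e)" for n by (rule vt) simp
    have "(\<lambda>n. v + (inverse (real (Suc n)) * K) *\<^sub>R e) \<longlonglongrightarrow> v + (0 * K) *\<^sub>R e"
      by (intro tendsto_intros LIMSEQ_inverse_real_of_nat)
    then show "(\<lambda>n. v + (inverse (real (Suc n)) * K) *\<^sub>R e) \<longlonglongrightarrow> v" by simp
  qed
  have "pos (w \<odot> r)" by (rule lim) (rule *)
  moreover have "pos (s *\<^sub>R (- (w \<odot> r)) + (s\<^sup>2 * K) *\<^sub>R e)" for s using *[of "- s"] by simp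
  then have "pos (- (w \<odot> r))" by (rule lim)
  ultimately show ?thesis by (rule pos_antisym)
qed

end


section \<open>Monotone completeness\<close>

text \<open>Banach-Alaoglu for families of balls, obtained from compactness of a product of real
  intervals.\<close>

lemma dual_of_banach_ball_fip:
  fixes c :: "'i \<Rightarrow> 'a::banach" and r :: "'i \<Rightarrow> real"
  assumes dual: "dual_of_banach TYPE('a) (P :: 'p::banach itself)"
    and fip: "\<And>J. finite J \<Longrightarrow> J \<subseteq> I \<Longrightarrow> \<exists>w. \<forall>i\<in>J. norm (w - c i) \<le> r i"
  shows "\<exists>w. \<forall>i\<in>I. norm (w - c i) \<le> r i"
proof (cases "I = {}")
  case False
  then obtain k where k: "k \<in> I" by blast
  obtain T :: "'a \<Rightarrow> ('p \<Rightarrow>\<^sub>L real)" where T: "linear T" "bij T" "\<And>x. norm (T x) = norm x"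
    using dual by (auto simp: dual_of_banach_def)
  \<comment> \<open>Functionals are plain functions here, so that linearity and the norm bound are
    closed conditions on coordinates. Boundedness is recovered afterwards from the one ball
    \<open>B k\<close>.\<close>
  define B where "B i = {\<phi> :: 'p \<Rightarrow> real. (\<forall>u v. \<phi> (u + v) = \<phi> u + \<phi> v) \<and>
    (\<forall>t v. \<phi> (t *\<^sub>R v) = t * \<phi> v) \<and> (\<forall>v. \<bar>\<phi> v - blinfun_apply (T (c i)) v\<bar> \<le> r i * norm v)}" for i
  define K where "K = PiE (UNIV :: 'p set) (\<lambda>v. cball (blinfun_apply (T (c k)) v) (r k * norm v))"
  have "compactin (product_topology (\<lambda>_. euclidean) UNIV) K"
    unfolding K_def compactin_PiE by (simp add: compactin_euclidean_iff)
  then have cK: "compact K" by (simp add: euclidean_product_topology compactin_euclidean_iff)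
  have clB: "closed (B i)" for i
    unfolding B_def
    by (intro closed_Collect_conj closed_Collect_all closed_Collect_eq closed_Collect_le
        continuous_intros continuous_on_product_coordinates)
  have mem: "blinfun_apply (T w) \<in> B i" if w: "norm (w - c i) \<le> r i" for w i
  proof -
    have "\<bar>blinfun_apply (T w) v - blinfun_apply (T (c i)) v\<bar> \<le> r i * norm v" for v
    proof -
      have "\<bar>blinfun_apply (T w) v - blinfun_apply (T (c i)) v\<bar> = norm (blinfun_apply (T (w - c i)) v)"
        by (simp add: linear_diff[OF T(1)] blinfun.diff_left)
      also have "\<dots> \<le> norm (w - c i) * norm v" using norm_blinfun[of "T (w - c i)" v] T(3) by simp
      also have "\<dots> \<le> r i * norm v" using w by (simp add: mult_right_mono)
      finally show ?thesis .
    qed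
    then show ?thesis by (simp add: B_def blinfun.add_right blinfun.scaleR_right)
  qed
  have BK: "B k \<subseteq> K"
    by (auto simp: B_def K_def dist_real_def abs_minus_commute)
  have fB: "K \<inter> (\<Inter>i\<in>J. B i) \<noteq> {}" if J: "finite J" "J \<subseteq> I" for J
  proof -
    obtain w where "\<forall>i\<in>insert k J. norm (w - c i) \<le> r i" using fip[of "insert k J"] J k by auto
    then have "blinfun_apply (T w) \<in> K \<inter> (\<Inter>i\<in>J. B i)" using mem BK by blast
    then show ?thesis by blast
  qed
  have "K \<inter> (\<Inter>i\<in>I. B i) \<noteq> {}" by (rule compact_imp_fip_image[OF cK clB fB])
  then obtain \<phi> where \<phi>: "\<And>i. i \<in> I \<Longrightarrow> \<phi> \<in> B i" by blast
  have "bounded_linear \<phi>"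
  proof (rule bounded_linear_intro)
    show "norm (\<phi> v) \<le> norm v * (norm (T (c k)) + r k)" for v
    proof -
      have "\<bar>\<phi> v - blinfun_apply (T (c k)) v\<bar> \<le> r k * norm v" using \<phi>[OF k] by (simp add: B_def)
      moreover have "\<bar>blinfun_apply (T (c k)) v\<bar> \<le> norm (T (c k)) * norm v"
        using norm_blinfun[of "T (c k)" v] by simp
      ultimately show ?thesis by (simp add: algebra_simps)
    qed
  qed (use \<phi>[OF k] in \<open>auto simp: B_def\<close>)
  define w where "w = inv T (Blinfun \<phi>)"
  have "T w = Blinfun \<phi>" unfolding w_def using T(2) by (simp add: bij_is_surj surj_f_inv_f)
  then have Tw: "blinfun_apply (T w) = \<phi>" using \<open>bounded_linear \<phi>\<close> by (simp add: bounded_linear_Blinfun_apply)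
  have "norm (w - c i) \<le> r i" if i: "i \<in> I" for i
  proof -
    have "0 \<le> r i" using fip[of "{i}"] i norm_ge_zero order.trans by blast
    then have "norm (T (w - c i)) \<le> r i"
      using \<phi>[OF i] by (intro norm_blinfun_bound)
        (auto simp: B_def linear_diff[OF T(1)] blinfun.diff_left Tw)
    then show ?thesis by (simp add: T)
  qed
  then show ?thesis by blast
qed simp

sublocale JBW_algebra \<subseteq> JB_unit jp e
  by unfold_locales (rule unit)

context JBW_algebra begin

text \<open>Order intervals are intersections of two balls, hence weak* compact.\<close>
lemma chain_has_sup:
  assumes A: "A \<noteq> {}" "\<And>a. a \<in> A \<Longrightarrow> pos a \<and> pos (e - a)"
    and chain: "\<And>a b. a \<in> A \<Longrightarrow> b \<in> A \<Longrightarrow> pos (b - a) \<or> pos (a - b)"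
  obtains r where "is_sup A r"
proof -
  define U where "U = {u. \<forall>a\<in>A. pos (u - a)}"
  \<comment> \<open>Lying in the ball of an index \<open>Inl a\<close> forces a point above
    \<open>a\<close>, and that of \<open>Inr u\<close> forces it below \<open>u\<close>. The radius
    \<open>norm u + 1\<close> bounds the distance from \<open>u\<close> to any effect, so the
    largest of finitely many chain elements lies in all the selected balls.\<close>
  define c where "c = case_sum (\<lambda>a. a + e) (\<lambda>u. u - (norm u + 1) *\<^sub>R e)"
  define R where "R = case_sum (\<lambda>_::'a. 1) (\<lambda>u::'a. norm u + 1)"
  have max: "\<exists>m\<in>A. \<forall>a\<in>F. pos (m - a)" if "finite F" "F \<subseteq> A" for F
    using that
  proof (induction F rule: finite_induct)
    case empty
    then show ?case using A by auto
  next
    case (insert x F)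
    then obtain m where m: "m \<in> A" "\<forall>a\<in>F. pos (m - a)" by auto
    show ?case
    proof (cases "pos (m - x)")
      case True then show ?thesis using m by auto
    next
      case False
      then have xm: "pos (x - m)" using chain[of m x] m insert by auto
      have "\<forall>a\<in>F. pos (x - a)" using m(2) pos_trans[OF _ xm] by blast
      then show ?thesis using insert by (intro bexI[of _ x]) (auto simp: pos_0)
    qed
  qed
  have "\<exists>w. \<forall>i\<in>A <+> U. norm (w - c i) \<le> R i"
  proof (rule dual_of_banach_ball_fip[OF dual])
    fix J assume J: "finite J" "J \<subseteq> A <+> U"
    have "finite (Inl -` J)" using J by (intro finite_vimageI) auto
    moreover have "Inl -` J \<subseteq> A" using J by auto
    ultimately obtain m where m: "m \<in> A" "\<forall>a \<in> Inl -` J. pos (m - a)" using max by blast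
    have m1: "norm m \<le> 1" using A(2)[OF m(1)] by (intro pos_norm_mono) auto
    have "norm (m - c i) \<le> R i" if i: "i \<in> J" for i
    proof (cases i)
      case (Inl a)
      then have a: "a \<in> A" "pos (m - a)" using J i m by auto
      have "pos (e - m + a)" using A(2)[OF a(1)] A(2)[OF m(1)] by (intro pos_add) auto
      then have "norm (m - a) \<le> 1" using a by (intro pos_norm_mono) (auto simp: algebra_simps)
      then have "norm (1 *\<^sub>R e - (m - a)) \<le> 1" using pos_iff a(2) by blast
      then show ?thesis using norm_minus_commute[of e "m - a"] by (simp add: Inl c_def R_def diff_diff_eq)
    next
      case (Inr u)
      then have u: "pos (u - m)" using J i m by (auto simp: U_def)
      have "norm (u - m) \<le> norm u + 1" using m1 norm_triangle_ineq4[of u m] by simp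
      then have "norm ((norm u + 1) *\<^sub>R e - (u - m)) \<le> norm u + 1" using pos_iff u by blast
      then show ?thesis by (simp add: Inr c_def R_def algebra_simps)
    qed
    then show "\<exists>w. \<forall>i\<in>J. norm (w - c i) \<le> R i" by blast
  qed
  then obtain w where w: "\<And>i. i \<in> A <+> U \<Longrightarrow> norm (w - c i) \<le> R i" by blast
  have "pos (w - a)" if "a \<in> A" for a
  proof (rule pos_root[of 1])
    show "norm (1 *\<^sub>R e - (w - a)) \<le> 1"
      using w[OF InlI[OF that]] norm_minus_commute[of e "w - a"] by (simp add: c_def R_def diff_diff_eq)
  qed (auto simp: pos_square)
  moreover have "pos (u - w)" if "u \<in> U" for u
  proof (rule pos_root[of "norm u + 1"])
    show "norm ((norm u + 1) *\<^sub>R e - (u - w)) \<le> norm u + 1"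
      using w[OF InrI[OF that]] by (simp add: c_def R_def algebra_simps)
  qed (auto simp: pos_square)
  ultimately show ?thesis using that by (auto simp: is_sup_def U_def)
qed

text \<open>The source of projections: both uses below feed \<open>2 m - m^2\<close> back into the
  maximality of \<open>m\<close>. Zorn's lemma applies because suprema of chains remain annihilated
  by \<open>W\<close>.\<close>

lemma maximal_annihilator:
  fixes W :: "'a set"
  assumes q: "pos q" "pos (e - q)"
  obtains m where "pos m" "pos (q - m)" "\<forall>w\<in>W. jp w m = 0"
    "\<And>a. pos a \<Longrightarrow> pos (q - a) \<Longrightarrow> \<forall>w\<in>W. jp w a = 0 \<Longrightarrow> pos (a - m) \<Longrightarrow> a = m"
proof -
  define S where "S = {a. pos a \<and> pos (q - a) \<and> (\<forall>w\<in>W. jp w a = 0)}"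
  have "\<exists>m\<in>S. \<forall>a\<in>S. pos (a - m) \<longrightarrow> a = m"
  proof (rule predicate_Zorn)
    show "partial_order_on S (relation_of (\<lambda>a b. pos (b - a)) S)"
    proof (rule partial_order_on_relation_ofI)
      show "a = b" if "pos (b - a)" "pos (a - b)" for a b
        using pos_antisym[of "b - a"] that by simp
      show "pos (c - a)" if "pos (b - a)" "pos (c - b)" for a b c
        using that by (rule pos_trans)
    qed (simp add: pos_0)
    fix C assume "C \<in> Chains (relation_of (\<lambda>a b. pos (b - a)) S)"
    then have C: "\<And>a b. a \<in> C \<Longrightarrow> b \<in> C \<Longrightarrow> pos (b - a) \<or> pos (a - b)"
      and CS: "\<And>a. a \<in> C \<Longrightarrow> a \<in> S"
      by (auto simp: Chains_def relation_of_def)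
    show "\<exists>u\<in>S. \<forall>a\<in>C. pos (u - a)"
    proof (cases "C = {}")
      case True
      then show ?thesis using q by (intro bexI[of _ 0]) (auto simp: S_def pos_0 jp_zero_right)
    next
      case False
      have C1: "pos a \<and> pos (e - a)" if "a \<in> C" for a
        using CS[OF that] pos_trans[of q a e] q by (auto simp: S_def)
      obtain r where r: "is_sup C r" using chain_has_sup[OF False C1 C] by blast
      have qr: "pos (q - r)" using r CS by (auto simp: is_sup_def S_def)
      then have er: "pos (e - r)" using pos_trans q by blast
      obtain a where a: "a \<in> C" using False by blast
      have "pos (r - a + a)" using r a C1 by (intro pos_add) (auto simp: is_sup_def)
      moreover have "jp w r = 0" if "w \<in> W" for w
        using CS C1 that by (intro sup_annihilates[OF r _ er]) (auto simp: S_def)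
      ultimately have "r \<in> S" using qr by (simp add: S_def)
      then show ?thesis using r by (auto simp: is_sup_def)
    qed
  qed
  then obtain m where "m \<in> S" "\<And>a. a \<in> S \<Longrightarrow> pos (a - m) \<Longrightarrow> a = m" by blast
  then show ?thesis using that[of m] by (simp add: S_def)
qed

end


section \<open>Peirce decomposition\<close>

lemma scaleR_small:
  fixes x :: "'a::real_vector"
  shows "2 *\<^sub>R x = x + x" "3 *\<^sub>R x = x + x + x" "4 *\<^sub>R x = x + x + x + x"
    "6 *\<^sub>R x = x + x + x + x + x + x" "(3/2) *\<^sub>R x = x + (1/2) *\<^sub>R x"
  using scaleR_add_left[of 1 1 x] scaleR_add_left[of 2 1 x] scaleR_add_left[of 3 1 x]
    scaleR_add_left[of 3 3 x]
    scaleR_add_left[of 1 "1/2" x] by simp_all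

lemma scaleR_half_sum: "(1/2) *\<^sub>R x + (1/2) *\<^sub>R x = (x :: 'a::real_vector)"
  using scaleR_add_left[of "1/2" "1/2" x] by simp

locale JB_projection = JB_unit jp e for jp :: "'a::banach \<Rightarrow> 'a \<Rightarrow> 'a" (infixl "\<odot>" 70) and e +
  fixes p :: 'a
  assumes idem: "p \<odot> p = p"
begin

lemma complement: "JB_projection (\<odot>) e (e - p)"
  by unfold_locales (simp add: jp_linear unit unit_right idem)

text \<open>The three projections are the Lagrange polynomials, in multiplication by
  \<open>p\<close>, for its eigenvalues 1, 1/2 and 0.\<close>

definition P1 :: "'a \<Rightarrow> 'a" where "P1 y = 2 *\<^sub>R (p \<odot> (p \<odot> y)) - p \<odot> y"
definition Ph :: "'a \<Rightarrow> 'a" where "Ph y = 4 *\<^sub>R (p \<odot> y) - 4 *\<^sub>R (p \<odot> (p \<odot> y))"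
definition P0 :: "'a \<Rightarrow> 'a" where "P0 y = y - 3 *\<^sub>R (p \<odot> y) + 2 *\<^sub>R (p \<odot> (p \<odot> y))"

text \<open>Passing to \<open>e - p\<close> exchanges the Peirce 1- and 0-spaces, so results on
  \<open>P0\<close> transfer to \<open>P1\<close>.\<close>

lemma complement_P0: "JB_projection.P0 (\<odot>) (e - p) = P1"
proof -
  interpret c: JB_projection "(\<odot>)" e "e - p" by (rule complement)
  show ?thesis
    by (rule ext, simp add: c.P0_def P1_def jp_linear unit algebra_simps, simp add: scaleR_small)
qed

text \<open>Multiplication by \<open>p\<close> is a root of \<open>2 t^3 - 3 t^2 + t\<close>, whose
  zeros are 0, 1/2 and 1.\<close>

lemma peirce_cubic: "p \<odot> (p \<odot> (p \<odot> w)) = (3/2) *\<^sub>R (p \<odot> (p \<odot> w)) - (1/2) *\<^sub>R (p \<odot> w)"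
proof -
  have "p \<odot> (p \<odot> w) + p \<odot> (p \<odot> w) + p \<odot> (p \<odot> w) =
      p \<odot> (p \<odot> (p \<odot> w)) + p \<odot> (p \<odot> (p \<odot> w)) + p \<odot> w"
    using jordan_linearized[of p p p w] by (simp add: idem commute[of w p] commute[of "p \<odot> w" p])
  then have "2 *\<^sub>R (p \<odot> (p \<odot> (p \<odot> w))) = 3 *\<^sub>R (p \<odot> (p \<odot> w)) - p \<odot> w"
    by (simp add: scaleR_small(1,2))
  then have "(1/2) *\<^sub>R (2 *\<^sub>R (p \<odot> (p \<odot> (p \<odot> w)))) = (1/2) *\<^sub>R (3 *\<^sub>R (p \<odot> (p \<odot> w)) - p \<odot> w)"
    by simp
  then show ?thesis by (simp add: scaleR_diff_right)
qed

lemma P_eigen: "p \<odot> P1 y = P1 y" "p \<odot> Ph y = (1/2) *\<^sub>R Ph y" "p \<odot> P0 y = 0"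
  by (simp_all add: P1_def Ph_def P0_def jp_linear peirce_cubic algebra_simps)
    (simp_all add: scaleR_small)

lemma P_sum: "y = P1 y + Ph y + P0 y"
  by (simp add: P1_def Ph_def P0_def algebra_simps) (simp_all add: scaleR_small)

lemma P_add: "P1 (x + y) = P1 x + P1 y" "Ph (x + y) = Ph x + Ph y" "P0 (x + y) = P0 x + P0 y"
  and P_diff: "P1 (x - y) = P1 x - P1 y" "Ph (x - y) = Ph x - Ph y" "P0 (x - y) = P0 x - P0 y"
  and P_scale: "P1 (c *\<^sub>R x) = c *\<^sub>R P1 x" "Ph (c *\<^sub>R x) = c *\<^sub>R Ph x" "P0 (c *\<^sub>R x) = c *\<^sub>R P0 x"
  and P_zero: "P1 0 = 0" "Ph 0 = 0" "P0 0 = 0"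
  by (simp_all add: P1_def Ph_def P0_def jp_linear algebra_simps)

lemmas P_linear = P_add P_diff P_scale P_zero

lemma P_on_M1: "p \<odot> a = a \<Longrightarrow> P1 a = a \<and> Ph a = 0 \<and> P0 a = 0"
  by (simp add: P1_def Ph_def P0_def algebra_simps) (simp_all add: scaleR_small)

lemma P_on_M0: "p \<odot> a = 0 \<Longrightarrow> P1 a = 0 \<and> Ph a = 0 \<and> P0 a = a"
  by (simp add: P1_def Ph_def P0_def jp_linear)

lemma P_on_Mh: "p \<odot> a = (1/2) *\<^sub>R a \<Longrightarrow> P1 a = 0 \<and> Ph a = a \<and> P0 a = 0"
  by (simp add: P1_def Ph_def P0_def jp_linear algebra_simps) (simp_all add: scaleR_small)

lemma continuous_on_P0: "continuous_on S f \<Longrightarrow> continuous_on S (\<lambda>x. P0 (f x))"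
  unfolding P0_def by (intro continuous_intros jp_continuous_intros)

text \<open>Source of the Peirce multiplication rules with a factor outside the 1/2-space:
  polarization yields \<open>(1 - 2 j) (p (a b) - i (a b)) = 0\<close>.\<close>

lemma mult_eigen:
  assumes a: "p \<odot> a = i *\<^sub>R a" and b: "p \<odot> b = j *\<^sub>R b" and j: "j \<noteq> 1/2"
  shows "p \<odot> (a \<odot> b) = i *\<^sub>R (a \<odot> b)"
proof -
  have "(2 * i * j) *\<^sub>R (a \<odot> b) + p \<odot> (a \<odot> b) = (2 * j) *\<^sub>R (p \<odot> (a \<odot> b)) + i *\<^sub>R (a \<odot> b)"
    using jordan_linearized[of p a p b]
    by (simp add: a b idem jp_linear commute[of a p] commute[of b p] commute[of b a] commute[of "a \<odot> b" p]
        algebra_simps flip: scaleR_add_left)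
  then have "(1 - 2 * j) *\<^sub>R (p \<odot> (a \<odot> b) - i *\<^sub>R (a \<odot> b)) = 0"
    by (simp add: algebra_simps)
  then show ?thesis using j by simp
qed

lemma M1_M1: "p \<odot> a = a \<Longrightarrow> p \<odot> b = b \<Longrightarrow> p \<odot> (a \<odot> b) = a \<odot> b"
  using mult_eigen[of a 1 b 1] by simp

lemma M0_any: "p \<odot> a = i *\<^sub>R a \<Longrightarrow> p \<odot> b = 0 \<Longrightarrow> p \<odot> (a \<odot> b) = i *\<^sub>R (a \<odot> b)"
  using mult_eigen[of a i b 0] by simp

lemma M0_M0: "p \<odot> a = 0 \<Longrightarrow> p \<odot> b = 0 \<Longrightarrow> p \<odot> (a \<odot> b) = 0"
  using M0_any[of a 0 b] by simp

lemma M1_M0: assumes "p \<odot> a = a" "p \<odot> b = 0" shows "a \<odot> b = 0"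
  using mult_eigen[of a 1 b 0] mult_eigen[of b 0 a 1] assms commute[of a b] by simp

lemma M1_Mh: "p \<odot> a = a \<Longrightarrow> p \<odot> v = (1/2) *\<^sub>R v \<Longrightarrow> p \<odot> (a \<odot> v) = (1/2) *\<^sub>R (a \<odot> v)"
  using mult_eigen[of v "1/2" a 1] by (simp add: commute[of a v])

lemma M0_Mh: "p \<odot> a = 0 \<Longrightarrow> p \<odot> v = (1/2) *\<^sub>R v \<Longrightarrow> p \<odot> (a \<odot> v) = (1/2) *\<^sub>R (a \<odot> v)"
  using mult_eigen[of v "1/2" a 0] by (simp add: commute[of a v])

lemma Mh_Mh:
  assumes "p \<odot> a = (1/2) *\<^sub>R a" "p \<odot> b = (1/2) *\<^sub>R b"
  shows "p \<odot> (p \<odot> (a \<odot> b)) = p \<odot> (a \<odot> b)" "Ph (a \<odot> b) = 0"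
proof -
  show "p \<odot> (p \<odot> (a \<odot> b)) = p \<odot> (a \<odot> b)"
    using jordan_linearized[of p p a b] assms
    by (simp add: idem jp_linear commute[of a p] commute[of b p] commute[of b a])
  then show "Ph (a \<odot> b) = 0" by (simp add: Ph_def)
qed

text \<open>Twice the multiplication by \<open>a\<close> represents the Peirce 0-space on the
  1/2-space as a Jordan homomorphism. This is the action on which the argument rests.\<close>

lemma M0_hom:
  assumes "p \<odot> a = 0" "p \<odot> b = 0" "p \<odot> v = (1/2) *\<^sub>R v"
  shows "(a \<odot> b) \<odot> v = a \<odot> (b \<odot> v) + b \<odot> (a \<odot> v)"
proof -
  have "(1/2) *\<^sub>R ((a \<odot> b) \<odot> v) = (1/2) *\<^sub>R (a \<odot> (b \<odot> v)) + (1/2) *\<^sub>R (b \<odot> (a \<odot> v))"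
    using jordan_linearized'[of p a b v] M0_Mh[OF assms(1) M0_Mh[OF assms(2,3)]] assms
    by (simp add: jp_linear commute[of b a])
  then have "2 *\<^sub>R ((1/2) *\<^sub>R ((a \<odot> b) \<odot> v)) = 2 *\<^sub>R ((1/2) *\<^sub>R (a \<odot> (b \<odot> v)) + (1/2) *\<^sub>R (b \<odot> (a \<odot> v)))"
    by simp
  then show ?thesis by (simp add: scaleR_add_right)
qed

lemma M1_hom:
  assumes "p \<odot> a = a" "p \<odot> b = b" "p \<odot> v = (1/2) *\<^sub>R v"
  shows "(a \<odot> b) \<odot> v = a \<odot> (b \<odot> v) + b \<odot> (a \<odot> v)"
proof -
  interpret c: JB_projection "(\<odot>)" e "e - p" by (rule complement)
  have "v - (1/2) *\<^sub>R v = (1/2) *\<^sub>R v" by (simp only: diff_eq_eq scaleR_half_sum)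
  then show ?thesis using assms by (intro c.M0_hom) (simp_all add: jp_linear unit)
qed

lemma mult_decomp:
  "P1 (a \<odot> b) = P1 a \<odot> P1 b + P1 (Ph a \<odot> Ph b)"
  "Ph (a \<odot> b) = P1 a \<odot> Ph b + P0 a \<odot> Ph b + Ph a \<odot> P1 b + Ph a \<odot> P0 b"
  "P0 (a \<odot> b) = P0 a \<odot> P0 b + P0 (Ph a \<odot> Ph b)"
proof -
  have eq: "a \<odot> b = P1 a \<odot> P1 b + P0 a \<odot> P0 b + Ph a \<odot> Ph b
      + (P1 a \<odot> Ph b + P0 a \<odot> Ph b + Ph a \<odot> P1 b + Ph a \<odot> P0 b)"
  proof -
    have "P1 a \<odot> P0 b = 0" "P0 a \<odot> P1 b = 0"
      using M1_M0[of "P1 a" "P0 b"] M1_M0[of "P1 b" "P0 a"] by (simp_all add: P_eigen commute[of "P0 a"])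
    then show ?thesis
      by (subst P_sum[of a], subst P_sum[of b]) (simp add: jp_linear)
  qed
  have 1: "p \<odot> (P1 a \<odot> P1 b) = P1 a \<odot> P1 b" by (intro M1_M1 P_eigen)
  have 2: "p \<odot> (P0 a \<odot> P0 b) = 0" by (intro M0_M0 P_eigen)
  have 3: "Ph (Ph a \<odot> Ph b) = 0" by (intro Mh_Mh P_eigen)
  have 4: "p \<odot> (P1 a \<odot> Ph b + P0 a \<odot> Ph b + Ph a \<odot> P1 b + Ph a \<odot> P0 b)
    = (1/2) *\<^sub>R (P1 a \<odot> Ph b + P0 a \<odot> Ph b + Ph a \<odot> P1 b + Ph a \<odot> P0 b)"
    using P_eigen by (simp add: jp_add_right M1_Mh M0_Mh commute[of "Ph a" "P1 b"] commute[of "Ph a" "P0 b"] scaleR_add_right)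
  show "P1 (a \<odot> b) = P1 a \<odot> P1 b + P1 (Ph a \<odot> Ph b)"
    "Ph (a \<odot> b) = P1 a \<odot> Ph b + P0 a \<odot> Ph b + Ph a \<odot> P1 b + Ph a \<odot> P0 b"
    "P0 (a \<odot> b) = P0 a \<odot> P0 b + P0 (Ph a \<odot> Ph b)"
    using P_on_M1[OF 1] P_on_M0[OF 2] P_on_Mh[OF 4] 3
    by (subst eq, simp only: P_add[of "P1 a \<odot> P1 b + P0 a \<odot> P0 b + Ph a \<odot> Ph b"]
        P_add[of "P1 a \<odot> P1 b + P0 a \<odot> P0 b"] P_add[of "P1 a \<odot> P1 b"], simp)+
qed

lemma P_idem: "P1 (P1 y) = P1 y" "Ph (Ph y) = Ph y" "P0 (P0 y) = P0 y"
   "P1 (P0 y) = 0" "P0 (P1 y) = 0" "P1 (Ph y) = 0" "P0 (Ph y) = 0" "Ph (P1 y) = 0" "Ph (P0 y) = 0"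
  using P_on_M1[of "P1 y"] P_on_M0[of "P0 y"] P_on_Mh[of "Ph y"] P_eigen by auto

text \<open>The map \<open>a - 2 Ph a\<close> is, in operator algebras, conjugation by the symmetry
  \<open>2 p - e\<close>. As a homomorphism it sends squares to squares.\<close>

lemma reflection_mult: "(a - 2 *\<^sub>R Ph a) \<odot> (b - 2 *\<^sub>R Ph b) = a \<odot> b - 2 *\<^sub>R Ph (a \<odot> b)"
proof -
  have r: "c - 2 *\<^sub>R Ph c = P1 c + P0 c - Ph c" for c
    by (subst (1) P_sum[of c]) (simp add: scaleR_2)
  have "P1 a \<odot> P0 b = 0" "P0 a \<odot> P1 b = 0"
    using M1_M0[of "P1 a" "P0 b"] M1_M0[of "P1 b" "P0 a"] by (simp_all add: P_eigen commute[of "P0 a"])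
  moreover have "a \<odot> b = (P1 a + Ph a + P0 a) \<odot> (P1 b + Ph b + P0 b)"
    using P_sum[of a] P_sum[of b] by simp
  ultimately show ?thesis
    unfolding r[of a] r[of b] mult_decomp(2) by (simp add: jp_linear scaleR_2)
qed

text \<open>Averaging \<open>b\<close> with its reflection shows that \<open>b - Ph b\<close> is
  positive. Its root can be taken in the subalgebra where \<open>Ph\<close> vanishes, and there
  \<open>P0\<close> is multiplicative.\<close>

lemma pos_P0: assumes "pos b" shows "pos (P0 b)"
proof -
  obtain c where c: "b = c \<odot> c" using assms by (auto simp: pos_def)
  have "pos (b - 2 *\<^sub>R Ph b)" using reflection_mult[of c c] pos_square by (simp add: c flip: reflection_mult)
  then have "pos ((1/2) *\<^sub>R (b + (b - 2 *\<^sub>R Ph b)))" using assms by (intro pos_scale pos_add) auto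
  then have m: "pos (b - Ph b)" by (simp add: algebra_simps flip: scaleR_add_left)
  define S where "S = {y. Ph y = 0}"
  have "jb_subalgebra (\<odot>) S"
    unfolding jb_subalgebra_def
  proof (intro conjI ballI)
    show "subspace S" by (auto simp: S_def subspace_def P_linear)
    show "closed S" unfolding S_def Ph_def
      by (intro closed_Collect_eq continuous_intros jp_continuous_intros)
    show "x \<odot> y \<in> S" if "x \<in> S" "y \<in> S" for x y
      using that by (simp add: S_def mult_decomp(2) jp_linear)
  qed
  moreover have "b - Ph b \<in> S" "e \<in> S" by (simp_all add: S_def P_linear P_idem) (simp add: Ph_def unit_right idem)
  ultimately obtain s where s: "b - Ph b = s \<odot> s" "s \<in> S" using pos_square_root[OF m] by blast
  have "P0 b = P0 (b - Ph b)" by (simp add: P_linear P_idem)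
  also have "\<dots> = P0 s \<odot> P0 s" using s(2) by (simp add: s(1) mult_decomp S_def jp_linear P_linear)
  finally show ?thesis by (simp add: pos_square)
qed

lemma pos_P1: assumes "pos b" shows "pos (P1 b)"
  using JB_projection.pos_P0[OF complement assms] by (simp add: complement_P0)

lemma pos_p: "pos p" and pos_complement: "pos (e - p)"
  using pos_square[of p] idem JB_projection.idem[OF complement] pos_square[of "e - p"] by simp_all

section \<open>Squares of Peirce 1/2-elements and the quadratic form\<close>

lemma cube_Mh:
  assumes "p \<odot> w = (1/2) *\<^sub>R w"
  shows "P1 (w \<odot> w) \<odot> w = (1/2) *\<^sub>R ((w \<odot> w) \<odot> w)" "P0 (w \<odot> w) \<odot> w = (1/2) *\<^sub>R ((w \<odot> w) \<odot> w)"
proof -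
  \<comment> \<open>A square from the 1/2-space has no 1/2-component, so \<open>P1\<close> acts on
    it as multiplication by \<open>p\<close>, which the Jordan identity moves onto the factor
    \<open>w\<close>.\<close>
  have "P1 (w \<odot> w) = p \<odot> (w \<odot> w)" using Mh_Mh(1)[OF assms assms] by (simp add: P1_def scaleR_2)
  then show 1: "P1 (w \<odot> w) \<odot> w = (1/2) *\<^sub>R ((w \<odot> w) \<odot> w)"
    using jordan[of w p] assms by (simp add: commute[of w "p \<odot> (w \<odot> w)"] commute[of w p] commute[of w "w \<odot> w"] jp_linear)
  have "w \<odot> w = P1 (w \<odot> w) + P0 (w \<odot> w)" using P_sum[of "w \<odot> w"] Mh_Mh(2)[OF assms assms] by simp
  then have "(w \<odot> w) \<odot> w = P1 (w \<odot> w) \<odot> w + P0 (w \<odot> w) \<odot> w"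
    by (simp flip: jp_add_left)
  then have "P0 (w \<odot> w) \<odot> w = (w \<odot> w) \<odot> w - P1 (w \<odot> w) \<odot> w" by simp
  then show "P0 (w \<odot> w) \<odot> w = (1/2) *\<^sub>R ((w \<odot> w) \<odot> w)"
    by (simp only: 1 diff_eq_eq scaleR_half_sum)
qed

lemma fourth_power: "(w \<odot> w) \<odot> (w \<odot> w) = w \<odot> ((w \<odot> w) \<odot> w)"
  using jpow_mult[of w 2 2] by (simp add: numeral_2_eq_2 unit_right commute[of w "w \<odot> w"] eval_nat_numeral)

lemma Mh_eq_0:
  assumes w: "p \<odot> w = (1/2) *\<^sub>R w" and z: "P0 (w \<odot> w) = 0 \<or> P1 (w \<odot> w) = 0"
  shows "w = 0"
proof -
  have "(1/2) *\<^sub>R ((w \<odot> w) \<odot> w) = 0" using z cube_Mh[OF w] by (auto simp: jp_linear)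
  then have "(w \<odot> w) \<odot> (w \<odot> w) = 0" by (simp add: fourth_power jp_linear)
  then show ?thesis by (simp add: square_eq_0_iff)
qed

text \<open>The 0-component of a square is the sum of two positive terms, one from
  \<open>P0 z\<close> and one from \<open>Ph z\<close>; both must vanish.\<close>

lemma P0_square_eq_0: assumes "P0 (z \<odot> z) = 0" shows "p \<odot> z = z"
proof -
  have eq: "P0 z \<odot> P0 z + P0 (Ph z \<odot> Ph z) = 0" using assms by (simp flip: mult_decomp(3))
  have "P0 z \<odot> P0 z = 0" by (rule pos_add_eq_0[OF pos_square pos_P0[OF pos_square] eq])
  moreover from this eq have "Ph z = 0" by (intro Mh_eq_0 P_eigen) simp
  ultimately have "z = P1 z" using P_sum[of z] by (simp add: square_eq_0_iff)
  with P_eigen(1)[of z] show ?thesis by simp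
qed

lemma P1_square_eq_0: assumes "P1 (z \<odot> z) = 0" shows "p \<odot> z = 0"
  using JB_projection.P0_square_eq_0[OF complement, of z] assms
  by (simp add: complement_P0 jp_linear unit)

lemma P0_pos_eq_0: assumes "pos b" "P0 b = 0" shows "p \<odot> b = b"
  using assms P0_square_eq_0 M1_M1 by (auto simp: pos_def)

lemma below_projection: assumes "pos b" "pos (p - b)" shows "p \<odot> b = b"
proof (rule P0_pos_eq_0)
  have "P0 p = 0" using P_on_M1[OF idem] by simp
  then have "pos (- P0 b)" using pos_P0[OF assms(2)] by (simp add: P_linear)
  then show "P0 b = 0" using pos_antisym[OF pos_P0[OF assms(1)]] by simp
qed (rule assms)

text \<open>\<open>P1 ((z \<odot> g) \<odot> g)\<close> is the quadratic form of the operator which \<open>z\<close> induces on the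
  Peirce 1/2-space.\<close>
lemma form_symmetric:
  assumes z: "p \<odot> z = 0" and u: "p \<odot> u = (1/2) *\<^sub>R u" and g: "p \<odot> g = (1/2) *\<^sub>R g"
  shows "P1 ((z \<odot> u) \<odot> g) = P1 (u \<odot> (z \<odot> g))"
proof -
  have zug: "P1 (z \<odot> (u \<odot> g)) = 0"
    using P_on_M0[OF z] Mh_Mh(2)[OF u g] by (subst mult_decomp(1)) (simp add: jp_linear P_linear)
  have "(1/2) *\<^sub>R (u \<odot> (z \<odot> g)) + (1/2) *\<^sub>R ((z \<odot> u) \<odot> g) = (1/2) *\<^sub>R (z \<odot> (u \<odot> g)) + p \<odot> ((z \<odot> u) \<odot> g)"
    using jordan_linearized[of z g u p] z u g
    by (simp add: jp_linear commute[of u p] commute[of z p] commute[of g u] commute[of g "z \<odot> u"]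
        commute[of "z \<odot> g" u])
  from arg_cong[OF this, of P1]
  have "(1/2) *\<^sub>R P1 (u \<odot> (z \<odot> g)) + (1/2) *\<^sub>R P1 ((z \<odot> u) \<odot> g) = P1 (p \<odot> ((z \<odot> u) \<odot> g))"
    by (simp add: P_linear zug)
  also have "\<dots> = P1 ((z \<odot> u) \<odot> g)"
    using P_eigen(1)[of "(z \<odot> u) \<odot> g"] by (simp add: P1_def jp_linear)
  also have "\<dots> = (1/2) *\<^sub>R P1 ((z \<odot> u) \<odot> g) + (1/2) *\<^sub>R P1 ((z \<odot> u) \<odot> g)"
    by (simp only: scaleR_half_sum)
  finally show ?thesis by simp
qed

text \<open>The analogue of writing the form of \<open>c^2\<close> at a vector as the squared norm
  of its image under \<open>c\<close>: symmetry moves one factor \<open>c\<close> across.\<close>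

lemma form_square:
  assumes c: "p \<odot> c = 0" and g: "p \<odot> g = (1/2) *\<^sub>R g"
  shows "P1 (((c \<odot> c) \<odot> g) \<odot> g) = 2 *\<^sub>R P1 ((c \<odot> g) \<odot> (c \<odot> g))"
  using form_symmetric[OF c M0_Mh[OF c g] g]
  by (simp add: M0_hom[OF c c g] jp_linear P_linear scaleR_2)

lemma pos_root_M0:
  assumes "pos a" "p \<odot> a = 0"
  obtains c where "a = c \<odot> c" "p \<odot> c = 0"
proof -
  obtain c where c: "a = c \<odot> c" using assms(1) by (auto simp: pos_def)
  show thesis
    using P_on_M0[OF assms(2)] by (intro that[OF c] P1_square_eq_0) (simp flip: c)
qed

lemma form_pos:
  assumes "pos a" "p \<odot> a = 0" "p \<odot> g = (1/2) *\<^sub>R g" shows "pos (P1 ((a \<odot> g) \<odot> g))"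
proof -
  obtain c where c: "a = c \<odot> c" "p \<odot> c = 0" by (rule pos_root_M0[OF assms(1,2)])
  show ?thesis unfolding c(1) form_square[OF c(2) assms(3)] by (simp add: pos_scale pos_P1 pos_square)
qed

text \<open>The kernel of the action of the Peirce 0-space on the 1/2-space.\<close>

definition annihilator :: "'a set" where
  "annihilator = {z. p \<odot> z = 0 \<and> (\<forall>w. p \<odot> w = (1/2) *\<^sub>R w \<longrightarrow> z \<odot> w = 0)}"

text \<open>An ideal of the whole algebra: \<open>z\<close> kills the 1- and 1/2-components of
  \<open>y\<close>, and for the remaining \<open>P0 y\<close> the homomorphism property
  applies.\<close>

lemma annihilator_ideal: assumes z: "z \<in> annihilator" shows "z \<odot> y \<in> annihilator"
proof -
  have z0: "p \<odot> z = 0" and zw: "\<And>w. p \<odot> w = (1/2) *\<^sub>R w \<Longrightarrow> z \<odot> w = 0"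
    using z by (auto simp: annihilator_def)
  have "z \<odot> P1 y = 0" using M1_M0[OF P_eigen(1) z0] by (simp add: commute)
  then have zy: "z \<odot> y = z \<odot> P0 y"
    using zw[OF P_eigen(2)] by (subst P_sum[of y]) (simp add: jp_linear)
  show ?thesis
    unfolding annihilator_def zy using M0_M0[OF z0 P_eigen(3)]
    by (auto simp: M0_hom[OF z0 P_eigen(3)] zw M0_Mh P_eigen jp_linear)
qed

lemma subspace_annihilator: "subspace annihilator"
  by (auto simp: annihilator_def subspace_def jp_linear)

end


section \<open>Minimal projections in factors\<close>

context JBW_factor begin

text \<open>A maximal effect \<open>r\<close> of this ideal is a projection and a unit for it. A
  unit of an ideal is central, so \<open>r\<close> is a multiple of \<open>e\<close>; as
  \<open>q\<close> kills it, \<open>r = 0\<close>.\<close>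

lemma annihilator_trivial:
  assumes q: "jp q q = q" "q \<noteq> 0" and z: "z \<in> JB_projection.annihilator jp q"
  shows "z = 0"
proof -
  interpret Q: JB_projection jp e q by unfold_locales (rule q)
  define W where "W = insert q {w. jp q w = (1/2) *\<^sub>R w}"
  have ann_iff: "a \<in> Q.annihilator \<longleftrightarrow> (\<forall>w\<in>W. jp w a = 0)" for a
    by (auto simp: Q.annihilator_def W_def commute)
  have ann_sum: "a + b \<in> Q.annihilator" "a - b \<in> Q.annihilator" "c *\<^sub>R a \<in> Q.annihilator"
    if "a \<in> Q.annihilator" "b \<in> Q.annihilator" for a b c
    using that Q.subspace_annihilator by (auto intro: subspace_add subspace_diff subspace_scale)
  have ann_mult: "jp a b \<in> Q.annihilator" "jp b a \<in> Q.annihilator" if "a \<in> Q.annihilator" for a b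
    using Q.annihilator_ideal[OF that] by (simp_all add: commute[of b a])
  obtain r where r: "pos r" "pos (e - r)" "r \<in> Q.annihilator"
    and max: "\<And>a. pos a \<Longrightarrow> pos (e - a) \<Longrightarrow> a \<in> Q.annihilator \<Longrightarrow> pos (a - r) \<Longrightarrow> a = r"
    unfolding ann_iff by (rule maximal_annihilator[of e W]) (simp_all add: pos_e pos_0)
  have "norm r \<le> 1" using r by (intro pos_norm_mono) auto
  then have rr: "pos (r - jp r r)" using r by (intro square_le_self)
  \<comment> \<open>The competitor equals \<open>e - (e - r)^2\<close>, hence is again an effect,
    and exceeds \<open>r\<close> by \<open>r - r^2\<close>.\<close>
  have "2 *\<^sub>R r - jp r r = r"
  proof (rule max)
    show "pos (2 *\<^sub>R r - jp r r)" using pos_add[OF rr r(1)] by (simp add: scaleR_2 algebra_simps)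
    show "pos (e - (2 *\<^sub>R r - jp r r))"
      using pos_square[of "e - r"] by (simp add: jp_linear unit unit_right scaleR_2 algebra_simps)
    show "2 *\<^sub>R r - jp r r \<in> Q.annihilator" using r(3) by (intro ann_sum ann_mult)
    show "pos (2 *\<^sub>R r - jp r r - r)" using rr by (simp add: scaleR_2)
  qed
  then have idem: "jp r r = r" by (simp add: scaleR_2)
  interpret R: JB_projection jp e r by unfold_locales (rule idem)
  have P0: "R.P0 a = 0" if a: "pos a" "pos (e - a)" "a \<in> Q.annihilator" for a
  proof -
    have "r + R.P0 a = r"
    proof (rule max)
      show "pos (r + R.P0 a)" using a r by (intro pos_add R.pos_P0)
      have "R.P0 e = e - r" by (simp add: R.P0_def unit_right idem scaleR_small)
      then show "pos (e - (r + R.P0 a))" using R.pos_P0[OF a(2)] by (simp add: R.P_linear diff_diff_eq)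
      have "R.P0 a \<in> Q.annihilator"
        unfolding R.P0_def using a(3) by (intro ann_sum ann_mult)
      then show "r + R.P0 a \<in> Q.annihilator" using r(3) by (intro ann_sum)
      show "pos (r + R.P0 a - r)" using R.pos_P0[OF a(1)] by simp
    qed
    then show ?thesis by simp
  qed
  have r_unit: "jp r a = a" if a: "a \<in> Q.annihilator" for a
  proof (rule R.P0_square_eq_0)
    have "R.P0 ((1 / (norm (jp a a) + 1)) *\<^sub>R jp a a) = 0"
      using a by (intro P0 normalized_square ann_sum ann_mult)
    moreover have "norm (jp a a) + 1 > 0" by (rule add_nonneg_pos) simp_all
    ultimately show "R.P0 (jp a a) = 0" by (simp add: R.P_linear)
  qed
  \<comment> \<open>As \<open>r y\<close> lies in the ideal, \<open>r\<close> fixes it; hence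
    multiplication by \<open>r\<close> is idempotent and the 1/2-space of \<open>r\<close> is
    zero.\<close>
  have P1: "R.P1 y = jp r y" and Ph: "R.Ph y = 0" for y
    using r_unit[OF ann_mult(1)[OF r(3)], of y] by (simp_all add: R.P1_def R.Ph_def scaleR_2)
  have "jp r (jp y w) = jp y (jp r w)" for y w
  proof -
    have "jp r (jp y w) = jp (R.P1 y) (R.P1 w)"
      using R.mult_decomp(1)[of y w] by (simp add: P1[symmetric] Ph jp_linear R.P_linear)
    also have "\<dots> = jp (R.P1 y + R.Ph y + R.P0 y) (R.P1 w)"
      using R.M1_M0[OF R.P_eigen(1) R.P_eigen(3), of w y] by (simp add: Ph jp_linear commute)
    finally show ?thesis by (simp only: P1[symmetric] R.P_sum[symmetric])
  qed
  then have "jb_central jp r" by (simp add: jb_central_def operator_commute_def)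
  then obtain c where c: "r = c *\<^sub>R e" using factor by blast
  have "jp q r = 0" using r(3) by (simp add: Q.annihilator_def)
  then have "r = 0" using q c by (simp add: jp_linear unit_right)
  then show ?thesis using r_unit[OF z] by (simp add: jp_linear)
qed

text \<open>The associative Peirce algebra of \<open>p\<close> has no zero divisors, since a zero
  divisor would annihilate the 1/2-space of some nonzero projection. Then every element is
  comparable with 0, and a totally ordered algebra of this kind consists of the multiples of
  \<open>p\<close>.\<close>

lemma abelian_projection_minimal:
  assumes ab: "abelian_projection jp p" and y: "jp p y = y"
  obtains c where "y = c *\<^sub>R p"
proof (cases "p = 0")
  case True
  then show ?thesis using that[of 0] y by (simp add: jp_linear)
next
  case False
  have idem: "jp p p = p" using ab by (simp add: abelian_projection_def jb_projection_def)
  interpret P: JB_projection jp e p by unfold_locales (rule idem)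
  have assoc: "jp (jp a b) c = jp a (jp b c)" if "jp p a = a" "jp p b = b" "jp p c = c" for a b c
  proof -
    have "jb_U jp p a = P.P1 a" for a by (simp add: jb_U_def P.P1_def idem)
    then have "a \<in> range (jb_U jp p)" if "jp p a = a" for a
      using P.P_on_M1[OF that] by (metis rangeI)
    then have "a \<in> range (jb_U jp p)" "b \<in> range (jb_U jp p)" "c \<in> range (jb_U jp p)"
      using that by blast+
    then show ?thesis using ab unfolding abelian_projection_def by blast
  qed
  have domain: "a1 = 0" if a: "jp p a1 = a1" "jp p a2 = a2" "jp a1 a2 = 0" "a2 \<noteq> 0" for a1 a2
  proof -
    define b where "b = (1 / (norm (jp a2 a2) + 1)) *\<^sub>R jp a2 a2"
    have "norm (jp a2 a2) + 1 > 0" by (rule add_nonneg_pos) simp_all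
    then have b0: "b \<noteq> 0" using a(4) by (simp add: b_def square_eq_0_iff)
    have pb: "jp p b = b" using P.M1_M1[OF a(2) a(2)] by (simp add: b_def jp_linear)
    have "P.P1 e = p" by (simp add: P.P1_def unit_right idem scaleR_2)
    then have "pos (p - b)"
      using P.pos_P1[OF normalized_square(2)[of a2]] P.P_on_M1[OF pb] by (simp add: P.P_linear flip: b_def)
    have "jp a1 b = 0"
      using assoc[OF a(1,2,2)] a(3) by (simp add: b_def jp_linear)
    have pc: "pos (e - p)" by (rule P.pos_complement)
    obtain m where m: "pos m" "pos (p - m)" "jp a1 m = 0"
      and max: "\<And>a. pos a \<Longrightarrow> pos (p - a) \<Longrightarrow> jp a1 a = 0 \<Longrightarrow> pos (a - m) \<Longrightarrow> a = m"
      by (rule maximal_annihilator[OF P.pos_p pc, of "{a1}"]) simp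
    have "m \<noteq> 0"
      using max[of b] b0 \<open>pos (p - b)\<close> \<open>jp a1 b = 0\<close> normalized_square(1)[of a2] by (auto simp flip: b_def)
    have pm: "jp p m = m" using P.below_projection m by blast
    have "norm m \<le> 1" using m pos_trans[OF m(2) pc] by (intro pos_norm_mono) auto
    then have mm: "pos (m - jp m m)" using m by (intro square_le_self)
    have "2 *\<^sub>R m - jp m m = m"
    proof (rule max)
      show "pos (2 *\<^sub>R m - jp m m)" using pos_add[OF mm m(1)] by (simp add: scaleR_2 algebra_simps)
      show "pos (p - (2 *\<^sub>R m - jp m m))"
        using pos_square[of "p - m"] by (simp add: jp_linear idem pm commute[of m p] scaleR_2 algebra_simps)
      show "jp a1 (2 *\<^sub>R m - jp m m) = 0"
        using assoc[OF a(1) pm pm] m(3) by (simp add: jp_linear)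
      show "pos (2 *\<^sub>R m - jp m m - m)" using mm by (simp add: scaleR_2)
    qed
    then have mi: "jp m m = m" by (simp add: scaleR_2)
    interpret M: JB_projection jp e m by unfold_locales (rule mi)
    have "jp a1 w = 0" if w: "jp m w = (1/2) *\<^sub>R w" for w
    proof -
      have mP: "P.P1 m = m" "P.Ph m = 0" "P.P0 m = 0" using P.P_on_M1[OF pm] by auto
      have "P.P0 (jp m w) = 0" by (subst P.mult_decomp(3)) (simp add: mP jp_linear P.P_linear)
      then have w0: "P.P0 w = 0" by (simp add: w P.P_linear)
      have "P.P1 (jp m w) = jp m (P.P1 w)" by (subst P.mult_decomp(1)) (simp add: mP jp_linear P.P_linear)
      then have w1: "jp m (P.P1 w) = (1/2) *\<^sub>R P.P1 w" by (simp add: w P.P_linear)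
      \<comment> \<open>Associativity turns the eigenvalue 1/2 into 1/2 = 1/4, so \<open>w\<close>
        has no component in the Peirce 1-space of \<open>p\<close>.\<close>
      have "jp (jp m m) (P.P1 w) = jp m (jp m (P.P1 w))" by (intro assoc pm P.P_eigen)
      then have "P.P1 w = 0" by (simp add: w1 mi jp_linear)
      then have wP: "w = P.Ph w" using P.P_sum[of w] w0 by simp
      have pw: "jp p w = (1/2) *\<^sub>R w" using P.P_eigen(2)[of w] wP by simp
      have "jp (jp a1 m) w = jp a1 (jp m w) + jp m (jp a1 w)"
        by (rule P.M1_hom[OF a(1) pm pw])
      then have u: "jp m (jp a1 w) = - ((1/2) *\<^sub>R jp a1 w)"
        by (simp add: m(3) w jp_linear add_eq_0_iff)
      \<comment> \<open>A nonzero \<open>a1 w\<close> would be an eigenvector of \<open>m\<close>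
        for -1/2, which the Peirce cubic excludes: its two sides are -1/8 and 5/8.\<close>
      have "- ((1/8) *\<^sub>R jp a1 w) = (5/8) *\<^sub>R jp a1 w"
        using M.peirce_cubic[of "jp a1 w"] by (simp add: u jp_linear flip: scaleR_add_left)
      then have "(1/8 + 5/8 :: real) *\<^sub>R jp a1 w = 0"
        by (simp only: scaleR_add_left flip: \<open>- _ = _\<close>) simp
      then show ?thesis by simp
    qed
    then have "a1 \<in> M.annihilator" using m(3) by (simp add: M.annihilator_def commute)
    then show "a1 = 0" using annihilator_trivial[OF mi \<open>m \<noteq> 0\<close>] by blast
  qed
  \<comment> \<open>With \<open>a\<close> the absolute value of \<open>u\<close>, the product
    \<open>(a - u)(a + u)\<close> is zero, so one factor vanishes.\<close>
  have comparable: "pos u \<or> pos (- u)" if u: "jp p u = u" for u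
  proof -
    obtain a where a: "jp u u = jp a a" "pos a" using pos_square_root[OF pos_square] by metis
    have "P.P0 (jp u u) = 0" using P.P_on_M1[OF P.M1_M1[OF u u]] by simp
    then have pa: "jp p a = a" using a by (intro P.P0_square_eq_0) simp
    have "jp (a - u) (a + u) = 0" by (simp add: jp_linear a commute)
    then have "a - u = 0 \<or> a + u = 0" using domain[of "a - u" "a + u"] u pa by (auto simp: jp_linear)
    then show ?thesis using a(2) by (auto simp: add_eq_0_iff)
  qed
  define L where "L = {l. pos (y - l *\<^sub>R p)}"
  have P1e: "P.P1 e = p" by (simp add: P.P1_def unit_right idem scaleR_2)
  have "pos (P.P1 (norm y *\<^sub>R e - y))" "pos (P.P1 (norm y *\<^sub>R e - (- y)))"
    using pos_norm_e_minus[of y "norm y"] pos_norm_e_minus[of "- y" "norm y"] by (intro P.pos_P1; simp)+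
  then have yb: "pos (norm y *\<^sub>R p - y)" "pos (y + norm y *\<^sub>R p)"
    using P.P_on_M1[OF y] P.P_linear(2)[of 0 y] by (simp_all add: P.P_linear P1e algebra_simps)
  have Lle: "l \<le> norm y" if "l \<in> L" for l
  proof (rule ccontr)
    assume "\<not> l \<le> norm y"
    then have l: "l - norm y > 0" by simp
    have "pos ((norm y - l) *\<^sub>R p)"
      using pos_add[OF yb(1), of "y - l *\<^sub>R p"] that by (simp add: L_def algebra_simps)
    moreover have "pos ((l - norm y) *\<^sub>R p)" using l P.pos_p by (intro pos_scale) auto
    ultimately have "(l - norm y) *\<^sub>R p = 0" by (intro pos_antisym) (simp_all add: algebra_simps)
    then show False using False l by simp
  qed
  then have bdd: "bdd_above L" by (auto simp: bdd_above_def)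
  have ne: "L \<noteq> {}" using yb(2) by (auto simp: L_def intro!: exI[of _ "- norm y"])
  have "closed ((\<lambda>l. y - l *\<^sub>R p) -` {a. pos a})"
    by (intro closed_vimage closed_pos continuous_intros)
  then have "closed L" by (simp add: L_def vimage_def)
  then have SL: "pos (y - Sup L *\<^sub>R p)" using closed_contains_Sup[OF ne bdd] by (simp add: L_def)
  \<comment> \<open>Just beyond the supremum the difference is not positive, hence negative by
    comparability; the limit keeps the sign.\<close>
  have "pos (- (y - Sup L *\<^sub>R p))"
  proof (rule pos_limit)
    show "pos (- (y - (Sup L + inverse (real (Suc n))) *\<^sub>R p))" for n
    proof -
      have "Sup L + inverse (real (Suc n)) \<notin> L"
        using cSup_upper[OF _ bdd, of "Sup L + inverse (real (Suc n))"] by fastforce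
      then show ?thesis
        using comparable[of "y - (Sup L + inverse (real (Suc n))) *\<^sub>R p"]
        by (auto simp: L_def jp_linear y idem)
    qed
    have "(\<lambda>n. - (y - (Sup L + inverse (real (Suc n))) *\<^sub>R p)) \<longlonglongrightarrow> - (y - (Sup L + 0) *\<^sub>R p)"
      by (intro tendsto_intros LIMSEQ_inverse_real_of_nat)
    then show "(\<lambda>n. - (y - (Sup L + inverse (real (Suc n))) *\<^sub>R p)) \<longlonglongrightarrow> - (y - Sup L *\<^sub>R p)" by simp
  qed
  then have "y - Sup L *\<^sub>R p = 0" using SL pos_antisym by blast
  then show ?thesis using that[of "Sup L"] by simp
qed

end

context JBW_factor_type_I begin

lemma minimal_projection_exists:
  assumes "e \<noteq> 0"
  obtains p where "jp p p = p" "p \<noteq> 0" "\<And>y. jp p y = y \<Longrightarrow> \<exists>c. y = c *\<^sub>R p"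
proof -
  obtain p where p: "abelian_projection jp p" "is_central_cover jp p e" using type_I by blast
  have "p \<noteq> 0"
  proof
    assume "p = 0"
    moreover have "jb_projection jp 0" "jb_central jp 0"
      by (simp_all add: jb_projection_def jb_central_def operator_commute_def jp_linear)
    ultimately have "jb_le jp e 0" using p(2) by (auto simp: is_central_cover_def jb_le_iff pos_0)
    then show False using pos_antisym[OF pos_e] assms by (simp add: jb_le_iff)
  qed
  moreover have "jp p p = p" using p by (simp add: abelian_projection_def jb_projection_def)
  ultimately show ?thesis using that abelian_projection_minimal[OF p(1)] by metis
qed

end


section \<open>Atoms and the characterization of invertible effects\<close>

text \<open>The assumption \<open>annihilator_0\<close> is faithfulness of the action on the
  1/2-space, the form in which the factor hypothesis enters the estimates.\<close>

locale JB_minimal_projection = JB_projection jp e p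
  for jp :: "'a::banach \<Rightarrow> 'a \<Rightarrow> 'a" (infixl "\<odot>" 70) and e p +
  assumes nonzero: "p \<noteq> 0"
    and minimal: "p \<odot> y = y \<Longrightarrow> \<exists>c. y = c *\<^sub>R p"
    and annihilator_0: "z \<in> annihilator \<Longrightarrow> z = 0"
begin

lemma pos_scale_p: "pos (c *\<^sub>R p) \<longleftrightarrow> c \<ge> 0"
proof
  assume c: "pos (c *\<^sub>R p)"
  show "c \<ge> 0"
  proof (rule ccontr)
    assume "\<not> c \<ge> 0"
    then have "pos (- (c *\<^sub>R p))" using pos_scale[OF pos_p, of "- c"] by simp
    then show False using pos_antisym[OF c] nonzero \<open>\<not> c \<ge> 0\<close> by simp
  qed
qed (simp add: pos_scale pos_p)

text \<open>Minimality makes \<open>P1 (g^2)\<close> a multiple \<open>t p\<close>, whence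
  \<open>g^3 = t g\<close> and \<open>g^4 = t g^2\<close>; comparing norms gives
  \<open>t = (norm g)^2\<close>. So the norm of the 1/2-space comes from an inner product, with
  values read off along \<open>p\<close>.\<close>

lemma Mh_square:
  assumes g: "p \<odot> g = (1/2) *\<^sub>R g"
  shows "P1 (g \<odot> g) = (norm g)\<^sup>2 *\<^sub>R p"
    and "P0 (g \<odot> g) \<odot> g = ((norm g)\<^sup>2 / 2) *\<^sub>R g"
    and "P0 (g \<odot> g) \<odot> P0 (g \<odot> g) = (norm g)\<^sup>2 *\<^sub>R P0 (g \<odot> g)"
    and "g \<odot> g = (norm g)\<^sup>2 *\<^sub>R p + P0 (g \<odot> g)"
proof -
  obtain t where t: "P1 (g \<odot> g) = t *\<^sub>R p" using minimal[OF P_eigen(1)] by blast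
  have "2 *\<^sub>R ((1/2) *\<^sub>R ((g \<odot> g) \<odot> g)) = 2 *\<^sub>R (t *\<^sub>R ((1/2) *\<^sub>R g))"
    using cube_Mh(1)[OF g] by (simp add: t g jp_linear)
  then have cube: "(g \<odot> g) \<odot> g = t *\<^sub>R g" by simp
  have fourth: "(g \<odot> g) \<odot> (g \<odot> g) = t *\<^sub>R (g \<odot> g)"
    by (simp add: fourth_power cube jp_linear)
  have t0: "t \<ge> 0" using pos_P1[OF pos_square, of g] by (simp add: t pos_scale_p)
  have tn: "t = (norm g)\<^sup>2"
  proof (cases "g = 0")
    case True
    then show ?thesis using t nonzero by (simp add: jp_linear P_linear)
  next
    case False
    have "norm ((g \<odot> g) \<odot> (g \<odot> g)) = t * norm (g \<odot> g)" by (simp add: fourth t0)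
    then have "(norm g)\<^sup>2 * (norm g)\<^sup>2 = t * (norm g)\<^sup>2"
      by (simp add: norm_square power2_eq_square)
    then show ?thesis using False by (simp only: mult_cancel_right) simp
  qed
  show "P1 (g \<odot> g) = (norm g)\<^sup>2 *\<^sub>R p" using t tn by simp
  show "P0 (g \<odot> g) \<odot> g = ((norm g)\<^sup>2 / 2) *\<^sub>R g"
    using cube_Mh(2)[OF g] by (simp add: cube tn)
  show gg: "g \<odot> g = (norm g)\<^sup>2 *\<^sub>R p + P0 (g \<odot> g)"
    using P_sum[of "g \<odot> g"] Mh_Mh(2)[OF g g] by (simp add: t tn)
  have "P0 ((g \<odot> g) \<odot> (g \<odot> g)) = P0 (g \<odot> g) \<odot> P0 (g \<odot> g)"
    by (subst mult_decomp(3)) (simp add: Mh_Mh(2)[OF g g] jp_linear P_linear)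
  then show "P0 (g \<odot> g) \<odot> P0 (g \<odot> g) = (norm g)\<^sup>2 *\<^sub>R P0 (g \<odot> g)"
    by (simp add: fourth P_linear tn)
qed

text \<open>If \<open>p\<close> is the projection onto the unit vector \<open>\<xi>\<close>, then \<open>h\<close> corresponds to a
  vector \<open>\<eta>\<close> orthogonal to \<open>\<xi>\<close>, and \<open>atom h\<close> is the positive operator of rank one
  given by \<open>\<xi> + \<eta>\<close>.\<close>
definition atom :: "'a \<Rightarrow> 'a" where "atom h = p + h + P0 (h \<odot> h)"

lemma atom_square:
  assumes h: "p \<odot> h = (1/2) *\<^sub>R h"
  shows "atom h \<odot> atom h = (1 + (norm h)\<^sup>2) *\<^sub>R atom h"
proof -
  define t b where "t = (norm h)\<^sup>2" and "b = P0 (h \<odot> h)"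
  have eqs: "h \<odot> h = t *\<^sub>R p + b" "b \<odot> h = (t/2) *\<^sub>R h" "b \<odot> b = t *\<^sub>R b" "p \<odot> b = 0"
    using Mh_square[OF h] P_eigen by (simp_all add: t_def b_def)
  have "atom h \<odot> atom h = p + 2 *\<^sub>R (p \<odot> h) + 2 *\<^sub>R (p \<odot> b) + h \<odot> h + 2 *\<^sub>R (b \<odot> h) + b \<odot> b"
    by (simp add: atom_def jp_linear idem commute[of h p] commute[of b p] commute[of h b] scaleR_2
        flip: b_def)
  also have "\<dots> = (1 + t) *\<^sub>R (p + h + b)"
    by (simp add: eqs h algebra_simps)
  finally show ?thesis by (simp add: t_def b_def atom_def)
qed

lemma pos_atom: assumes "p \<odot> h = (1/2) *\<^sub>R h" shows "pos (atom h)"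
proof -
  have "1 + (norm h)\<^sup>2 > 0" by (rule add_pos_nonneg) simp_all
  then have "atom h = (1 / (1 + (norm h)\<^sup>2)) *\<^sub>R (atom h \<odot> atom h)"
    using atom_square[OF assms] by simp
  then show ?thesis using pos_scale[OF pos_square] \<open>1 + (norm h)\<^sup>2 > 0\<close> by (metis divide_nonneg_pos zero_le_one)
qed

text \<open>For small \<open>h\<close> minimality of the atom follows from comparing norms of the Peirce components
  of an element of its Peirce 1-space.\<close>
lemma atom_minimal:
  assumes h: "p \<odot> h = (1/2) *\<^sub>R h" and small: "(norm h)\<^sup>2 < 1/2"
    and y: "atom h \<odot> y = (1 + (norm h)\<^sup>2) *\<^sub>R y"
  obtains c where "y = c *\<^sub>R atom h"
proof -
  define t b where "t = (norm h)\<^sup>2" and "b = P0 (h \<odot> h)"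
  have t: "t \<ge> 0" "t < 1/2" using small by (simp_all add: t_def)
  have "norm b * norm b = t * norm b"
    using arg_cong[OF Mh_square(3)[OF h], of norm] unfolding norm_square b_def t_def
    by (simp add: power2_eq_square)
  then have nb: "norm b \<le> t" using t by (cases "b = 0") auto
  have at: "P1 (atom h) = p" "Ph (atom h) = h" "P0 (atom h) = b"
    using P_on_M1[OF idem] P_on_Mh[OF h] by (simp_all add: atom_def P_linear P_idem b_def)
  obtain \<alpha> where \<alpha>: "P1 y = \<alpha> *\<^sub>R p" using minimal[OF P_eigen(1)] by blast
  \<comment> \<open>Subtracting this multiple removes the 1-component; the other two components are
    then shown to vanish.\<close>
  define z where "z = y - \<alpha> *\<^sub>R atom h"
  define v c where "v = Ph z" and "c = P0 z"
  have z1: "P1 z = 0" by (simp add: z_def P_linear \<alpha> at)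
  have z: "atom h \<odot> z = (1 + t) *\<^sub>R z"
    using y atom_square[OF h] by (simp add: z_def jp_linear t_def algebra_simps)
  have "P1 (h \<odot> v) = 0" using mult_decomp(1)[of "atom h" z] by (simp add: at z z1 P_linear jp_linear v_def)
  moreover have "Ph (h \<odot> v) = 0" unfolding v_def by (intro Mh_Mh h P_eigen)
  ultimately have hv: "P0 (h \<odot> v) = h \<odot> v" using P_sum[of "h \<odot> v"] by simp
  have c_eq: "(1 + t) *\<^sub>R c = b \<odot> c + h \<odot> v"
    using mult_decomp(3)[of "atom h" z] by (simp add: at z P_linear hv flip: v_def c_def)
  have v_eq: "(1 + t) *\<^sub>R v = (1/2) *\<^sub>R v + b \<odot> v + h \<odot> c"
    using mult_decomp(2)[of "atom h" z] P_eigen(2)[of z]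
    by (simp add: at z z1 P_linear jp_linear flip: v_def c_def)
  have "(1 + t) * norm c = norm (b \<odot> c + h \<odot> v)" using t by (simp flip: c_eq)
  also have "\<dots> \<le> norm b * norm c + norm h * norm v"
    by (intro norm_triangle_le add_mono norm_prod)
  also have "\<dots> \<le> t * norm c + norm h * norm v" using nb by (simp add: mult_right_mono)
  finally have nc: "norm c \<le> norm h * norm v" by (simp add: algebra_simps)
  have "(1/2 + t) *\<^sub>R v = b \<odot> v + h \<odot> c"
  proof -
    have "(1 + t) *\<^sub>R v = (1/2) *\<^sub>R v + (1/2 + t) *\<^sub>R v" by (simp flip: scaleR_add_left)
    then show ?thesis using v_eq by (simp add: add.assoc)
  qed
  then have "(1/2 + t) * norm v = norm (b \<odot> v + h \<odot> c)" using t by (metis abs_of_nonneg add_nonneg_nonneg norm_scaleR zero_le_divide_1_iff zero_le_numeral)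
  also have "\<dots> \<le> norm b * norm v + norm h * norm c"
    by (intro norm_triangle_le add_mono norm_prod)
  also have "\<dots> \<le> t * norm v + norm h * (norm h * norm v)"
    using nb nc by (intro add_mono mult_right_mono mult_left_mono) auto
  also have "\<dots> = 2 * t * norm v" by (simp add: t_def power2_eq_square)
  \<comment> \<open>Both terms on the right contribute \<open>t * norm v\<close>, against
    \<open>1/2 + t\<close> on the left: hence the threshold 1/2 for the squared norm of
    \<open>h\<close>.\<close>
  finally have "(1/2 - t) * norm v \<le> 0" by (simp add: algebra_simps)
  then have "norm v = 0" using t by (simp add: mult_le_0_iff)
  then have "v = 0" "c = 0" using nc by auto
  then have "z = 0" using P_sum[of z] z1 by (simp add: v_def c_def)
  then show ?thesis using that[of \<alpha>] by (simp add: z_def)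
qed

text \<open>A common lower bound with every nonzero effect forces \<open>x\<close> to dominate, uniformly by Baire's
  theorem, a multiple of each atom near \<open>p\<close>; averaging \<open>h + g\<close> and \<open>h - g\<close> leaves
  a bound on the quadratic part.\<close>
lemma common_lower_bounds_imp:
  assumes x: "pos x"
    and lb: "\<And>a. pos a \<Longrightarrow> pos (e - a) \<Longrightarrow> a \<noteq> 0 \<Longrightarrow> \<exists>b. b \<noteq> 0 \<and> pos b \<and> pos (a - b) \<and> pos (x - b)"
  obtains K where "K > 0" "pos (K *\<^sub>R x - p)"
    "\<And>g. p \<odot> g = (1/2) *\<^sub>R g \<Longrightarrow> pos ((K * (norm g)\<^sup>2) *\<^sub>R x - P0 (g \<odot> g))"
proof -
  \<comment> \<open>Radius 1/2 keeps the squared norm at most 1/4, within reach of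
    \<open>atom_minimal\<close>; closedness makes \<open>S\<close> complete for Baire's
    theorem.\<close>
  define S where "S = {h. p \<odot> h = (1/2) *\<^sub>R h \<and> norm h \<le> 1/2}"
  define F where "F n = {h \<in> S. pos (real n *\<^sub>R x - atom h)}" for n :: nat
  have closedS: "closed S" unfolding S_def
    by (intro closed_Collect_conj closed_Collect_eq closed_Collect_le continuous_intros jp_continuous_intros)
  have closedF: "closed (F n)" for n
  proof -
    have "closed ((\<lambda>h. real n *\<^sub>R x - atom h) -` {a. pos a})"
      unfolding atom_def
      by (intro closed_vimage closed_pos continuous_intros continuous_on_P0 jp_continuous_intros)
    moreover have "F n = S \<inter> (\<lambda>h. real n *\<^sub>R x - atom h) -` {a. pos a}" by (auto simp: F_def)
    ultimately show ?thesis using closedS by auto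
  qed
  have "\<exists>n. h \<in> F n" if h: "h \<in> S" for h
  proof -
    have hh: "p \<odot> h = (1/2) *\<^sub>R h" using h by (simp add: S_def)
    have "(norm h)\<^sup>2 \<le> (1/2)\<^sup>2" using h by (intro power_mono) (auto simp: S_def)
    then have small: "(norm h)\<^sup>2 < 1/2" by (simp add: power2_eq_square)
    define s where "s = 1 + (norm h)\<^sup>2"
    have s: "s > 0" unfolding s_def by (rule add_pos_nonneg) simp_all
    \<comment> \<open>The normalized atom is a projection, so a common lower bound lies in its
      Peirce 1-space and is by minimality a multiple of the atom.\<close>
    define q where "q = (1/s) *\<^sub>R atom h"
    have qa: "atom h = s *\<^sub>R q" using s by (simp add: q_def)
    have qq: "q \<odot> q = q" using atom_square[OF hh] s by (simp add: q_def jp_linear flip: s_def)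
    interpret Q: JB_projection "(\<odot>)" e q by unfold_locales (rule qq)
    have "P1 (atom h) = p" using P_on_M1[OF idem] P_on_Mh[OF hh] by (simp add: atom_def P_linear P_idem)
    then have "q \<noteq> 0" using nonzero qa by (auto simp: P_linear)
    then obtain b where b: "b \<noteq> 0" "pos b" "pos (q - b)" "pos (x - b)"
      using lb[OF Q.pos_p Q.pos_complement] by blast
    have "q \<odot> b = b" using Q.below_projection b by blast
    then have "atom h \<odot> b = (1 + (norm h)\<^sup>2) *\<^sub>R b" by (simp add: qa jp_linear s_def)
    then obtain c where c: "b = c *\<^sub>R atom h" using atom_minimal[OF hh small] by blast
    have "c > 0"
    proof (rule ccontr)
      assume "\<not> c > 0"
      then have "pos (- b)" using pos_scale[OF pos_atom[OF hh], of "- c"] c by simp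
      then show False using pos_antisym b by blast
    qed
    define n where "n = nat \<lceil>1/c\<rceil>"
    have n: "real n \<ge> 1/c" unfolding n_def by (simp add: real_nat_ceiling_ge)
    have "pos ((1/c) *\<^sub>R (x - b) + (real n - 1/c) *\<^sub>R x)"
      using b x n \<open>c > 0\<close> by (intro pos_add pos_scale) auto
    then have "pos (real n *\<^sub>R x - atom h)" using \<open>c > 0\<close> by (simp add: c algebra_simps)
    then show ?thesis using h by (auto simp: F_def)
  qed
  then have FS: "\<Union>(range F) = S" by (auto simp: F_def)
  have S0: "0 \<in> S" by (simp add: S_def jp_linear)
  have "\<exists>n. top_of_set S interior_of (F n) \<noteq> {}"
  proof (rule ccontr)
    assume none: "\<not> ?thesis"
    have "top_of_set S interior_of \<Union>(range F) = {}"
    proof (rule Baire_category_alt)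
      show "completely_metrizable_space (top_of_set S) \<or> locally_compact_space (top_of_set S) \<and> regular_space (top_of_set S)"
        using completely_metrizable_space_closedin[OF completely_metrizable_space_euclidean] closedS by auto
      show "closedin (top_of_set S) T \<and> top_of_set S interior_of T = {}" if "T \<in> range F" for T
      proof -
        obtain n where T: "T = F n" using \<open>T \<in> range F\<close> by blast
        have "F n \<subseteq> S" by (auto simp: F_def)
        then show ?thesis using none closed_subset closedF T by blast
      qed
    qed simp
    moreover have "top_of_set S interior_of S = S"
      using interior_of_topspace[of "top_of_set S"] by simp
    ultimately show False using S0 FS by simp
  qed
  then obtain n h0 where "h0 \<in> top_of_set S interior_of (F n)" by blast
  then obtain T where T: "open T" "h0 \<in> S \<inter> T" "S \<inter> T \<subseteq> F n"
    by (auto simp: interior_of_def openin_open)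
  obtain \<epsilon> where \<epsilon>: "\<epsilon> > 0" "ball h0 \<epsilon> \<subseteq> T" using T openE by blast
  \<comment> \<open>Since \<open>h0\<close> may lie on the boundary of \<open>S\<close>, it is
    shrunk by \<open>1 - s\<close>. A full ball of radius \<open>s/2\<close> in the 1/2-space around
    \<open>h\<close> then stays in \<open>S\<close> and within \<epsilon> of
    \<open>h0\<close>.\<close>
  define s where "s = min \<epsilon> 1 / 2"
  have s: "0 < s" "s \<le> \<epsilon>/2" "s \<le> 1/2" using \<epsilon> by (auto simp: s_def)
  define h where "h = (1 - s) *\<^sub>R h0"
  have h: "p \<odot> h = (1/2) *\<^sub>R h" using T(2) by (simp add: S_def h_def jp_linear)
  define \<delta> where "\<delta> = s / 2"
  have \<delta>: "\<delta> > 0" using s by (simp add: \<delta>_def)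
  have near: "h + g \<in> F n" if g: "p \<odot> g = (1/2) *\<^sub>R g" "norm g \<le> \<delta>" for g
  proof -
    have h0: "norm h0 \<le> 1/2" using T(2) by (simp add: S_def)
    have "norm h = (1 - s) * norm h0" using s by (simp add: h_def)
    also have "\<dots> \<le> (1 - s) * (1/2)" using h0 s by (intro mult_left_mono) auto
    finally have "norm (h + g) \<le> 1/2" using g norm_triangle_ineq[of h g] by (simp add: \<delta>_def field_simps)
    then have 1: "h + g \<in> S" using g h by (simp add: S_def jp_linear scaleR_add_right)
    have eq: "h0 - (h + g) = s *\<^sub>R h0 - g" by (simp add: h_def algebra_simps)
    have "dist h0 (h + g) \<le> s * norm h0 + norm g"
      unfolding dist_norm eq using norm_triangle_ineq4[of "s *\<^sub>R h0" g] s by simp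
    also have "\<dots> \<le> s * (1/2) + s/2" using h0 g s by (intro add_mono mult_left_mono) (auto simp: \<delta>_def)
    also have "\<dots> < \<epsilon>" using s \<epsilon> by simp
    finally show ?thesis using 1 \<epsilon> T by auto
  qed
  have small: "pos (real n *\<^sub>R x - P0 (g \<odot> g))" if g: "p \<odot> g = (1/2) *\<^sub>R g" "norm g \<le> \<delta>" for g
  proof -
    have "h + g \<in> F n" "h + (- g) \<in> F n" by (rule near; use g in \<open>simp add: jp_linear\<close>)+
    then have sum: "pos ((real n *\<^sub>R x - atom (h + g)) + (real n *\<^sub>R x - atom (h + (- g))))"
      unfolding F_def by (intro pos_add) blast+
    have "pos ((1/2) *\<^sub>R ((real n *\<^sub>R x - atom (h + g)) + (real n *\<^sub>R x - atom (h + (- g)))) + atom h)"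
      by (rule pos_add[OF pos_scale[OF sum] pos_atom[OF h]]) simp
    moreover have "(u - atom (h + g)) + (u - atom (h + (- g))) = 2 *\<^sub>R (u - P0 (g \<odot> g) - atom h)" for u
      by (simp add: atom_def square_add jp_linear P_linear scaleR_2 algebra_simps)
    ultimately show ?thesis by simp
  qed
  \<comment> \<open>The atom of 0 is \<open>p\<close> itself.\<close>
  obtain m where "0 \<in> F m" using S0 FS by blast
  then have m: "pos (real m *\<^sub>R x - p)" by (simp add: F_def atom_def jp_linear P_linear)
  \<comment> \<open>The first term comes from rescaling vectors to norm \<delta>, the second serves
    \<open>p\<close>, and the 1 makes \<open>K\<close> positive.\<close>
  define K where "K = real n / \<delta>\<^sup>2 + real m + 1"
  have K: "K > 0" "K \<ge> real m" "K \<ge> real n / \<delta>\<^sup>2" by (simp_all add: K_def add_nonneg_pos)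
  show ?thesis
  proof (rule that[OF K(1)])
    have "pos ((real m *\<^sub>R x - p) + (K - real m) *\<^sub>R x)" using m x K by (intro pos_add pos_scale) auto
    then show "pos (K *\<^sub>R x - p)" by (simp add: algebra_simps)
    fix g assume g: "p \<odot> g = (1/2) *\<^sub>R g"
    show "pos ((K * (norm g)\<^sup>2) *\<^sub>R x - P0 (g \<odot> g))"
    proof (cases "g = 0")
      case True
      then show ?thesis by (simp add: jp_linear P_linear pos_0)
    next
      case False
      define r where "r = \<delta> / norm g"
      have r: "r > 0" using \<delta> False by (simp add: r_def)
      have "pos (real n *\<^sub>R x - P0 ((r *\<^sub>R g) \<odot> (r *\<^sub>R g)))"
        using g False \<delta> by (intro small) (auto simp: jp_linear r_def)
      then have sum: "pos ((1/r\<^sup>2) *\<^sub>R (real n *\<^sub>R x - P0 ((r *\<^sub>R g) \<odot> (r *\<^sub>R g))) + ((K - real n / \<delta>\<^sup>2) * (norm g)\<^sup>2) *\<^sub>R x)"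
        using r x K by (intro pos_add pos_scale) auto
      have eq: "(1/r\<^sup>2) *\<^sub>R (real n *\<^sub>R x - P0 ((r *\<^sub>R g) \<odot> (r *\<^sub>R g)))
          = (real n / \<delta>\<^sup>2 * (norm g)\<^sup>2) *\<^sub>R x - P0 (g \<odot> g)"
        using r False \<delta> by (simp add: jp_linear P_linear scaleR_diff_right power2_eq_square r_def)
      show ?thesis using sum unfolding eq by (simp add: algebra_simps)
    qed
  qed
qed

end


section \<open>Lower bounds from the form and from the Peirce components\<close>

context JB_minimal_projection begin

text \<open>Writing \<open>a = \<bar>y\<bar>\<close> and \<open>v = a - y\<close>, the elements \<open>y \<odot> v\<^sup>2\<close> and
  \<open>a \<odot> v\<^sup>2\<close> have nonnegative forms and sum to zero.\<close>
lemma form_pos_imp_pos: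
  assumes y: "p \<odot> y = 0" and form: "\<And>g. p \<odot> g = (1/2) *\<^sub>R g \<Longrightarrow> pos (P1 ((y \<odot> g) \<odot> g))"
  shows "pos y"
proof -
  have "y \<odot> y \<in> alg y" by (intro alg_closed alg_self)
  then obtain a where a: "y \<odot> y = a \<odot> a" "a \<in> alg y" "pos a"
    using alg_root[OF pos_square] by blast
  obtain c where c: "a = c \<odot> c" "c \<in> alg y" using alg_root[OF a(3,2)] by blast
  have "P1 (a \<odot> a) = 0" using P_on_M0[OF M0_M0[OF y y]] by (simp add: a(1))
  then have pa: "p \<odot> a = 0" by (rule P1_square_eq_0)
  then have pc: "p \<odot> c = 0" using P_on_M0[OF pa] by (intro P1_square_eq_0) (simp add: c(1))
  define v where "v = a - y"
  have v: "v \<in> alg y" "p \<odot> v = 0" using a y pa by (simp_all add: v_def alg_closed alg_self jp_linear)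
  define k where "k = c \<odot> v"
  have pk: "p \<odot> k = 0" unfolding k_def by (rule M0_M0[OF pc v(2)])
  have av: "a \<odot> (v \<odot> v) = k \<odot> k"
    unfolding c(1) k_def by (rule alg_square_mult[OF c(2) v(1)])
  have "(a + y) \<odot> v = 0" by (simp add: v_def jp_linear a(1) commute[of y a])
  moreover have "a + y \<in> alg y" by (intro alg_closed a alg_self)
  ultimately have "(a + y) \<odot> (v \<odot> v) = 0"
    using alg_assoc[of "a + y" y v v] v by (simp add: jp_linear)
  then have sum: "y \<odot> (v \<odot> v) + k \<odot> k = 0" by (simp add: jp_linear av add.commute)
  have "k \<odot> g = 0" if g: "p \<odot> g = (1/2) *\<^sub>R g" for g
  proof -
    have vg: "p \<odot> (v \<odot> g) = (1/2) *\<^sub>R (v \<odot> g)" by (rule M0_Mh[OF v(2) g])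
    have yvg: "p \<odot> (y \<odot> (v \<odot> g)) = (1/2) *\<^sub>R (y \<odot> (v \<odot> g))" by (rule M0_Mh[OF y vg])
    have yv: "y \<odot> (v \<odot> w) = v \<odot> (y \<odot> w)" for w by (rule alg_commute[OF alg_self v(1)])
    \<comment> \<open>\<open>M0_hom\<close> gives \<open>2 y (v (v g)) + 2 v (v (y g))\<close>, and
      \<open>y\<close> and \<open>v\<close> operator commute. Moving the outer \<open>v\<close>
      across the form then leaves the form of \<open>y\<close> at \<open>v g\<close>.\<close>
    have "(y \<odot> (v \<odot> v)) \<odot> g = 4 *\<^sub>R (v \<odot> (y \<odot> (v \<odot> g)))"
      using M0_hom[OF y M0_M0[OF v(2) v(2)] g] M0_hom[OF v(2) v(2) g] M0_hom[OF v(2) v(2) M0_Mh[OF y g]]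
      by (simp add: jp_linear yv scaleR_small)
    then have "P1 (((y \<odot> (v \<odot> v)) \<odot> g) \<odot> g) = 4 *\<^sub>R P1 ((y \<odot> (v \<odot> g)) \<odot> (v \<odot> g))"
      using form_symmetric[OF v(2) yvg g] by (simp add: jp_linear P_linear)
    then have B: "pos (P1 (((y \<odot> (v \<odot> v)) \<odot> g) \<odot> g))" using form[OF vg] by (simp add: pos_scale)
    have kg: "P1 (((k \<odot> k) \<odot> g) \<odot> g) = 2 *\<^sub>R P1 ((k \<odot> g) \<odot> (k \<odot> g))"
      by (rule form_square[OF pk g])
    then have A: "pos (P1 (((k \<odot> k) \<odot> g) \<odot> g))" by (simp add: pos_scale pos_P1 pos_square)
    have C: "P1 (((k \<odot> k) \<odot> g) \<odot> g) + P1 (((y \<odot> (v \<odot> v)) \<odot> g) \<odot> g) = 0"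
      using arg_cong[OF sum, of "\<lambda>u. P1 ((u \<odot> g) \<odot> g)"] by (simp add: jp_linear P_linear add.commute)
    have "P1 (((k \<odot> k) \<odot> g) \<odot> g) = 0" by (rule pos_add_eq_0[OF A B C])
    then have "P1 ((k \<odot> g) \<odot> (k \<odot> g)) = 0" using kg by simp
    then show ?thesis by (rule Mh_eq_0[OF M0_Mh[OF pk g], OF disjI2])
  qed
  then have "k \<in> annihilator" using pk by (simp add: annihilator_def)
  then have "k = 0" by (rule annihilator_0)
  \<comment> \<open>Both \<open>a v^2 = k^2\<close> and \<open>y v^2 = - k^2\<close> are now zero,
    and \<open>v = a - y\<close>.\<close>
  then have "v \<odot> (v \<odot> v) = 0" using av sum by (subst v_def) (simp add: jp_linear)
  then have "(v \<odot> v) \<odot> (v \<odot> v) = 0" by (simp add: fourth_power commute[of "v \<odot> v" v] jp_linear)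
  then have "v = 0" by (simp add: square_eq_0_iff)
  then show ?thesis using a(3) by (simp add: v_def)
qed

text \<open>A weighted square absorbs the off-diagonal part \<open>v\<close>, at the price of a
  large multiple of \<open>p\<close> and a small multiple of \<open>e\<close>. The multiple of
  \<open>p\<close> is paid for by \<open>K x \<ge> p\<close>.\<close>

lemma pos_of_peirce_components:
  assumes x: "pos x" and K: "K > 0" "pos (K *\<^sub>R x - p)"
    and d: "d > 0" "pos (P0 x - d *\<^sub>R (e - p))"
  obtains c where "c > 0" "pos (x - c *\<^sub>R e)"
proof -
  define v t where "v = Ph x" and "t = (norm v)\<^sup>2"
  obtain \<alpha> where \<alpha>: "P1 x = \<alpha> *\<^sub>R p" using minimal[OF P_eigen(1)] by blast
  have pv: "p \<odot> v = (1/2) *\<^sub>R v" unfolding v_def by (rule P_eigen)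
  \<comment> \<open>Chosen so that the error \<open>t / k\<close> is at most \<open>d / 2\<close>;
    the 1 keeps \<open>k\<close> positive when \<open>t = 0\<close>.\<close>
  define k where "k = 2 * t / d + 1"
  have k: "k > 0" unfolding k_def using d by (intro add_nonneg_pos) (simp_all add: t_def)
  have "2 * t \<le> d * k" using d by (simp add: k_def field_simps)
  then have tk: "t / k \<le> d / 2" using k by (simp add: field_simps)
  have "pos ((sqrt k *\<^sub>R p + (1 / sqrt k) *\<^sub>R v) \<odot> (sqrt k *\<^sub>R p + (1 / sqrt k) *\<^sub>R v))"
    by (rule pos_square)
  moreover have "(sqrt k *\<^sub>R p + (1 / sqrt k) *\<^sub>R v) \<odot> (sqrt k *\<^sub>R p + (1 / sqrt k) *\<^sub>R v)
      = k *\<^sub>R p + v + (1/k) *\<^sub>R (v \<odot> v)"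
    unfolding square_add using k by (simp add: jp_linear idem pv)
  moreover have "pos ((1/k) *\<^sub>R (t *\<^sub>R e - v \<odot> v))"
    using k by (intro pos_scale pos_norm_e_minus) (simp_all add: t_def norm_square)
  ultimately have "pos (k *\<^sub>R p + v + (1/k) *\<^sub>R (v \<odot> v) + (1/k) *\<^sub>R (t *\<^sub>R e - v \<odot> v))"
    using pos_add by metis
  then have A: "pos (k *\<^sub>R p + v + (t/k) *\<^sub>R e)" by (simp add: scaleR_diff_right)
  have "pos (k *\<^sub>R p + v + (t/k) *\<^sub>R e + (P0 x - d *\<^sub>R (e - p)) + (d/2 - t/k) *\<^sub>R e)"
    by (rule pos_add[OF pos_add[OF A d(2)] pos_scale[OF pos_e]]) (use tk in simp)
  moreover have "k *\<^sub>R p + v + (t/k) *\<^sub>R e + (P0 x - d *\<^sub>R (e - p)) + (d/2 - t/k) *\<^sub>R e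
      = x + (k - \<alpha> + d) *\<^sub>R p - (d/2) *\<^sub>R e"
  proof -
    have "d *\<^sub>R e = (d/2) *\<^sub>R e + (d/2) *\<^sub>R e" by (simp flip: scaleR_add_left)
    then show ?thesis
      by (subst (2) P_sum[of x]) (simp add: \<alpha> algebra_simps flip: v_def)
  qed
  ultimately have 1: "pos (x + (k - \<alpha> + d) *\<^sub>R p - (d/2) *\<^sub>R e)" by simp
  \<comment> \<open>The coefficient of \<open>p\<close> may have either sign; its absolute value
    permits raising it before replacing \<open>p\<close> by \<open>K x\<close>.\<close>
  define \<beta> where "\<beta> = \<bar>k - \<alpha> + d\<bar>"
  have "pos (x + (k - \<alpha> + d) *\<^sub>R p - (d/2) *\<^sub>R e + (\<beta> - (k - \<alpha> + d)) *\<^sub>R p + \<beta> *\<^sub>R (K *\<^sub>R x - p))"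
    using K by (intro pos_add pos_scale 1 pos_p) (auto simp: \<beta>_def)
  then have 2: "pos ((1 + \<beta> * K) *\<^sub>R x - (d/2) *\<^sub>R e)" by (simp add: algebra_simps)
  define B where "B = 1 + \<beta> * K"
  have b: "B > 0" unfolding B_def using K by (intro add_pos_nonneg) (auto simp: \<beta>_def)
  then have "pos ((1 / B) *\<^sub>R (B *\<^sub>R x - (d/2) *\<^sub>R e))"
    using 2 by (intro pos_scale) (auto simp: B_def)
  then have "pos (x - (d / 2 / B) *\<^sub>R e)" using b by (simp add: scaleR_diff_right mult.commute)
  then show ?thesis using that[of "d / 2 / B"] b d by simp
qed

text \<open>Writing \<open>t = (norm g)^2\<close>, the form of \<open>P0 (g^2)\<close> at
  \<open>g\<close> is \<open>(t^2 / 2) p\<close>. Dividing the bound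
  \<open>K t x \<ge> P0 (g^2)\<close> by \<open>K t\<close> therefore gives
  \<open>(t / 2 / K) p\<close>, which is the form of \<open>(1/K) (e - p)\<close>, since
  \<open>e - p\<close> acts as 1/2.\<close>

lemma common_lower_bounds_imp_bounded_below:
  assumes x: "pos x"
    and lb: "\<And>a. pos a \<Longrightarrow> pos (e - a) \<Longrightarrow> a \<noteq> 0 \<Longrightarrow> \<exists>b. b \<noteq> 0 \<and> pos b \<and> pos (a - b) \<and> pos (x - b)"
  obtains c where "c > 0" "pos (x - c *\<^sub>R e)"
proof -
  obtain K where K: "K > 0" "pos (K *\<^sub>R x - p)"
    and Kg: "\<And>g. p \<odot> g = (1/2) *\<^sub>R g \<Longrightarrow> pos ((K * (norm g)\<^sup>2) *\<^sub>R x - P0 (g \<odot> g))"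
    using common_lower_bounds_imp[OF x lb] by blast
  have "pos (P0 x - (1/K) *\<^sub>R (e - p))"
  proof (rule form_pos_imp_pos)
    show "p \<odot> (P0 x - (1/K) *\<^sub>R (e - p)) = 0"
      by (simp add: jp_linear P_eigen unit_right idem)
    fix g assume g: "p \<odot> g = (1/2) *\<^sub>R g"
    show "pos (P1 (((P0 x - (1/K) *\<^sub>R (e - p)) \<odot> g) \<odot> g))"
    proof (cases "g = 0")
      case True
      then show ?thesis by (simp add: jp_linear P_linear pos_0)
    next
      case False
      define t where "t = (norm g)\<^sup>2"
      have t: "t > 0" using False by (simp add: t_def)
      have gg: "P1 (g \<odot> g) = t *\<^sub>R p" "P0 (g \<odot> g) \<odot> g = (t/2) *\<^sub>R g"
        using Mh_square[OF g] by (simp_all add: t_def)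
      let ?y = "(K * t) *\<^sub>R P0 x - P0 (g \<odot> g)"
      have "pos ?y" using pos_P0[OF Kg[OF g]] by (simp add: P_linear P_idem t_def)
      then have "pos (P1 ((?y \<odot> g) \<odot> g))" by (rule form_pos) (simp_all add: jp_linear P_eigen g)
      then have "pos ((1 / (K * t)) *\<^sub>R P1 ((?y \<odot> g) \<odot> g))" using K t by (intro pos_scale) auto
      moreover have "(1 / (K * t)) *\<^sub>R P1 ((?y \<odot> g) \<odot> g) = P1 ((P0 x \<odot> g) \<odot> g) - (t / 2 / K) *\<^sub>R p"
        using K t by (simp add: jp_linear P_linear gg scaleR_diff_right power2_eq_square)
      moreover have "(e - p) \<odot> g = (1/2) *\<^sub>R g"
        by (simp add: jp_linear unit g) (simp only: diff_eq_eq scaleR_half_sum)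
      then have "(P0 x - (1/K) *\<^sub>R (e - p)) \<odot> g = P0 x \<odot> g - (1 / K / 2) *\<^sub>R g"
        by (simp add: jp_diff_left[of "P0 x"] jp_scale_left)
      then have "P1 (((P0 x - (1/K) *\<^sub>R (e - p)) \<odot> g) \<odot> g) = P1 ((P0 x \<odot> g) \<odot> g) - (t / 2 / K) *\<^sub>R p"
        by (simp add: jp_linear P_linear gg mult.commute)
      ultimately show ?thesis by simp
    qed
  qed
  then show ?thesis using pos_of_peirce_components[OF x K, of "1/K"] K that by auto
qed

end

section \<open>Order characterization of invertible effects and its transport\<close>

context JBW_factor_type_I begin

lemma interval_iff: "a \<in> jb_interval jp 0 e \<longleftrightarrow> pos a \<and> pos (e - a)"
  by (simp add: jb_interval_def jb_le_iff)

lemma invertible_effect_iff: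
  assumes x: "x \<in> jb_interval jp 0 e"
  shows "x \<in> invertible_effects jp e \<longleftrightarrow>
    (\<forall>a\<in>jb_interval jp 0 e. a \<noteq> 0 \<longrightarrow>
      (\<exists>b\<in>jb_interval jp 0 e. b \<noteq> 0 \<and> jb_le jp b a \<and> jb_le jp b x))"
proof
  assume "x \<in> invertible_effects jp e"
  then obtain c where c: "c > 0" "pos (x - c *\<^sub>R e)"
    using jb_invertible_imp x by (auto simp: invertible_effects_def interval_iff)
  \<comment> \<open>The cap at 1 puts \<open>c' a\<close> below \<open>a\<close>.\<close>
  define c' where "c' = min c 1"
  have c': "0 < c'" "c' \<le> c" "c' \<le> 1" using c by (auto simp: c'_def)
  show "\<forall>a\<in>jb_interval jp 0 e. a \<noteq> 0 \<longrightarrow>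
      (\<exists>b\<in>jb_interval jp 0 e. b \<noteq> 0 \<and> jb_le jp b a \<and> jb_le jp b x)"
  proof (intro ballI impI)
    fix a assume a: "a \<in> jb_interval jp 0 e" "a \<noteq> 0"
    then have a': "pos a" "pos (e - a)" by (auto simp: interval_iff)
    have "pos ((1 - c') *\<^sub>R a)" using a' c' by (intro pos_scale) auto
    then have 1: "pos (a - c' *\<^sub>R a)" by (simp add: algebra_simps)
    have "pos ((x - c *\<^sub>R e) + (c - c') *\<^sub>R e + c' *\<^sub>R (e - a))"
      using a' c c' by (intro pos_add pos_scale pos_e) auto
    then have 2: "pos (x - c' *\<^sub>R a)" by (simp add: algebra_simps)
    have "pos (c' *\<^sub>R a)" "pos (e - c' *\<^sub>R a)"
      using a' c' pos_trans[OF 1 a'(2)] by (simp_all add: pos_scale)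
    then show "\<exists>b\<in>jb_interval jp 0 e. b \<noteq> 0 \<and> jb_le jp b a \<and> jb_le jp b x"
      using 1 2 a c' by (intro bexI[of _ "c' *\<^sub>R a"]) (auto simp: interval_iff jb_le_iff)
  qed
next
  assume lb: "\<forall>a\<in>jb_interval jp 0 e. a \<noteq> 0 \<longrightarrow>
      (\<exists>b\<in>jb_interval jp 0 e. b \<noteq> 0 \<and> jb_le jp b a \<and> jb_le jp b x)"
  have x': "pos x" "pos (e - x)" using x by (auto simp: interval_iff)
  obtain c where c: "c > 0" "pos (x - c *\<^sub>R e)"
  proof (cases "e = 0")
    \<comment> \<open>The hypotheses admit the zero algebra, which has no minimal
      projection.\<close>
    case True
    then show ?thesis using that[of 1] x' by simp
  next
    case False
    obtain p where p: "jp p p = p" "p \<noteq> 0" "\<And>y. jp p y = y \<Longrightarrow> \<exists>c. y = c *\<^sub>R p"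
      using minimal_projection_exists[OF False] by blast
    interpret JB_minimal_projection jp e p
    proof
      show "jp p p = p" "p \<noteq> 0" "\<And>y. jp p y = y \<Longrightarrow> \<exists>c. y = c *\<^sub>R p" by fact+
      show "z = 0" if "z \<in> JB_projection.annihilator jp p" for z
        using annihilator_trivial[OF p(1,2) that] .
    qed
    show ?thesis
    proof (rule common_lower_bounds_imp_bounded_below[OF x'(1)])
      show "\<exists>b. b \<noteq> 0 \<and> pos b \<and> pos (a - b) \<and> pos (x - b)" if "pos a" "pos (e - a)" "a \<noteq> 0" for a
      proof -
        have "a \<in> jb_interval jp 0 e" using that by (simp add: interval_iff)
        then obtain b where "b \<in> jb_interval jp 0 e" "b \<noteq> 0" "jb_le jp b a" "jb_le jp b x"
          using lb \<open>a \<noteq> 0\<close> by blast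
        then show ?thesis by (intro exI[of _ b]) (simp add: interval_iff jb_le_iff)
      qed
    qed (rule that)
  qed
  then have "jb_invertible jp e x" using x' by (intro jb_invertible_if)
  then show "x \<in> invertible_effects jp e" using x by (simp add: invertible_effects_def)
qed

lemma zero_in_interval: "0 \<in> jb_interval jp 0 e"
  by (simp add: interval_iff pos_0 pos_e)

end

theorem proposition4p6:
  fixes jpM :: "'a::banach \<Rightarrow> 'a \<Rightarrow> 'a" and eM :: 'a
    and jpN :: "'b::banach \<Rightarrow> 'b \<Rightarrow> 'b" and eN :: 'b
    and f :: "'a \<Rightarrow> 'b"
  assumes "JBW_factor_type_I jpM eM TYPE('p::banach)"
    and "JBW_factor_type_I jpN eN TYPE('q::banach)"
    and "order_isomorphism_on (jb_le jpM) (jb_interval jpM 0 eM)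
           (jb_le jpN) (jb_interval jpN 0 eN) f"
  shows "f ` invertible_effects jpM eM = invertible_effects jpN eN"
proof -
  interpret M: JBW_factor_type_I jpM eM "TYPE('p)" by (rule assms)
  interpret N: JBW_factor_type_I jpN eN "TYPE('q)" by (rule assms)
  let ?I = "jb_interval jpM 0 eM" and ?J = "jb_interval jpN 0 eN"
  have bij: "bij_betw f ?I ?J"
    and ord: "\<And>x y. x \<in> ?I \<Longrightarrow> y \<in> ?I \<Longrightarrow> jb_le jpN (f x) (f y) \<longleftrightarrow> jb_le jpM x y"
    using assms(3) by (auto simp: order_isomorphism_on_def)
  have img: "f ` ?I = ?J" and inj: "inj_on f ?I" using bij by (auto simp: bij_betw_def)
  \<comment> \<open>Zero is the least effect, so the order alone determines its image; nonzero
    effects then correspond to nonzero effects.\<close>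
  have f0: "f 0 = 0"
  proof -
    obtain w where w: "w \<in> ?I" "f w = 0" using N.zero_in_interval img by (metis imageE)
    have "jb_le jpM 0 w" using w by (simp add: jb_interval_def)
    then have "N.pos (- f 0)" using ord[OF M.zero_in_interval w(1)] w by (simp add: N.jb_le_iff)
    moreover have "N.pos (f 0)" using img M.zero_in_interval N.interval_iff by blast
    ultimately show ?thesis by (rule N.pos_antisym[rotated])
  qed
  have f_eq_0: "f b = 0 \<longleftrightarrow> b = 0" if "b \<in> ?I" for b
    using inj_onD[OF inj, of b 0] that M.zero_in_interval f0 by auto
  have iff: "f x \<in> invertible_effects jpN eN \<longleftrightarrow> x \<in> invertible_effects jpM eM" if x: "x \<in> ?I" for x
  proof -
    have fx: "f x \<in> ?J" using img x by blast
    have "(\<exists>b\<in>?J. b \<noteq> 0 \<and> jb_le jpN b (f a) \<and> jb_le jpN b (f x)) \<longleftrightarrow>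
        (\<exists>b\<in>?I. b \<noteq> 0 \<and> jb_le jpM b a \<and> jb_le jpM b x)" if a: "a \<in> ?I" for a
      unfolding img[symmetric] using a x by (simp add: ord f_eq_0 cong: bex_cong conj_cong)
    then show ?thesis
      unfolding M.invertible_effect_iff[OF x] N.invertible_effect_iff[OF fx]
      unfolding img[symmetric] by (simp add: f_eq_0 cong: ball_cong)
  qed
  have sub: "invertible_effects jpM eM \<subseteq> ?I" "invertible_effects jpN eN \<subseteq> ?J"
    by (auto simp: invertible_effects_def)
  show ?thesis
  proof
    show "f ` invertible_effects jpM eM \<subseteq> invertible_effects jpN eN" using iff sub by blast
    show "invertible_effects jpN eN \<subseteq> f ` invertible_effects jpM eM"
    proof
      fix y assume y: "y \<in> invertible_effects jpN eN"
      then obtain x where "x \<in> ?I" "y = f x" using sub img by blast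
      then show "y \<in> f ` invertible_effects jpM eM" using iff y by blast
    qed
  qed
qed

end
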